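(* Let $\Gamma_1$ and $\Gamma_2$ be two commensurable discrete lattices in $\mathrm{PU}(1,n)$. Denote by $\mathcal A_i$ the set of isogeny classes of the boundary abelian varieties for the toroidal compactification of the ball quotient $\Gamma_i\backslash\mathbb B^n$. Then $\mathcal A_1=\mathcal A_2$.
   Context: Let $W$ be a complex vector space with Hermitian form of signature $(1,n)$, and let $\mathbb B^n\subset\mathbb P(W)$ be the set of positive lines. Let $\Gamma\subset\mathrm{PU}(1,n)$ be a lattice. Replace $\Gamma$ by a torsion-free finite-index subgroup $\Gamma'$, small enough that stabilizers of cusps act by translations as described next. The quotient $\Gamma'\backslash\mathbb B^n$ is compactified (Siu--Yau; Satake--Baily--Borel in the arithmetic case) by finitely many cusps, which correspond to finitely many $\Gamma'$-orbits of isotropic lines $b\subset W$ with nontrivial stabilizer $\Gamma'_b$ in $\Gamma'$. The group $\Gamma'_b$ acts on the $(n-1)$-dimensional complex affine space $\mathbb P(W/b)\setminus\mathbb P(b^\perp/b)$ by translations, and the quotient $D_b=\Gamma'_b\backslash\left(\mathbb P(W/b)\setminus\mathbb P(b^\perp/b)\right)$ is an abelian variety of dimension $n-1$. The toroidal compactification (Ash--Mumford--Rapoport--Tai, Mok) adds these $D_b$ to $\Gamma'\backslash\mathbb B^n$ as boundary divisors. When $\Gamma$ has torsion, the toroidal compactification of $\Gamma\backslash\mathbb B^n$ is obtained by passing to such a $\Gamma'$ and taking the quotient; the boundary abelian varieties for $\Gamma$ are understood as the $D_b$ for such a $\Gamma'$ (well defined up to isogeny). Two subgroups of $\mathrm{PU}(1,n)$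 are commensurable if, up to conjugation in $\mathrm{PU}(1,n)$, they share a common finite-index subgroup. *)

theory Defs
  imports "HOL-Analysis.Analysis" "HOL-Algebra.Coset" "HOL-Algebra.Left_Coset"
begin

section \<open>Lattices in a group with a topology\<close>

definition quotient_topology :: "'a topology \<Rightarrow> ('a \<Rightarrow> 'b) \<Rightarrow> 'b topology" where
  "quotient_topology T q =
     topology (\<lambda>U. U \<subseteq> q ` topspace T \<and> openin T {x \<in> topspace T. q x \<in> U})"

lemma openin_quotient_topology:
  "openin (quotient_topology T q) U \<longleftrightarrow>
     U \<subseteq> q ` topspace T \<and> openin T {x \<in> topspace T. q x \<in> U}"
proof -
  have "istopology (\<lambda>U. U \<subseteq> q ` topspace T \<and> openin T {x \<in> topspace T. q x \<in> U})"
    unfolding istopology_def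
  proof (intro conjI allI impI; (elim conjE)?)
    fix S S'
    assume "openin T {x \<in> topspace T. q x \<in> S}" "openin T {x \<in> topspace T. q x \<in> S'}"
    then have "openin T ({x \<in> topspace T. q x \<in> S} \<inter> {x \<in> topspace T. q x \<in> S'})"
      by blast
    then show "openin T {x \<in> topspace T. q x \<in> S \<inter> S'}"
      by (rule back_subst[of "openin T"]) auto
  next
    fix K
    assume "\<forall>U\<in>K. U \<subseteq> q ` topspace T \<and> openin T {x \<in> topspace T. q x \<in> U}"
    then have "openin T (\<Union>U\<in>K. {x \<in> topspace T. q x \<in> U})"
      by blast
    then show "openin T {x \<in> topspace T. q x \<in> \<Union> K}"
      by (rule back_subst[of "openin T"]) auto
  qed auto
  then show ?thesis
    unfolding quotient_topology_def by simp
qed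

definition finite_index_subgroup :: "('a, 'b) monoid_scheme \<Rightarrow> 'a set \<Rightarrow> 'a set \<Rightarrow> bool" where
  "finite_index_subgroup G H K \<longleftrightarrow>
     subgroup K (G\<lparr>carrier := H\<rparr>) \<and> finite (rcosets\<^bsub>G\<lparr>carrier := H\<rparr>\<^esub> K)"

definition commensurable :: "('a, 'b) monoid_scheme \<Rightarrow> 'a set \<Rightarrow> 'a set \<Rightarrow> bool" where
  "commensurable G H1 H2 \<longleftrightarrow>
     (\<exists>g\<in>carrier G. \<exists>K. finite_index_subgroup G H1 K \<and>
        finite_index_subgroup G ((\<lambda>x. g \<otimes>\<^bsub>G\<^esub> x \<otimes>\<^bsub>G\<^esub> inv\<^bsub>G\<^esub> g) ` H2) K)"

definition torsion_free :: "('a, 'b) monoid_scheme \<Rightarrow> 'a set \<Rightarrow> bool" where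
  "torsion_free G H \<longleftrightarrow>
     (\<forall>x\<in>H. \<forall>k::nat. k > 0 \<longrightarrow> x [^]\<^bsub>G\<^esub> k = \<one>\<^bsub>G\<^esub> \<longrightarrow> x = \<one>\<^bsub>G\<^esub>)"

text \<open>A lattice is a discrete subgroup \<open>H\<close> such that \<open>G/H\<close> carries a nonzero finite
  \<open>G\<close>-invariant Borel measure.\<close>

definition lattice_subgroup :: "('a, 'b) monoid_scheme \<Rightarrow> 'a topology \<Rightarrow> 'a set \<Rightarrow> bool" where
  "lattice_subgroup G T H \<longleftrightarrow>
     subgroup H G \<and> subtopology T H = discrete_topology H \<and>
     (\<exists>\<mu>. space \<mu> = lcosets\<^bsub>G\<^esub> H \<and>
          sets \<mu> = sigma_sets (lcosets\<^bsub>G\<^esub> H)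
                     {U. openin (quotient_topology T (\<lambda>g. g <#\<^bsub>G\<^esub> H)) U} \<and>
          emeasure \<mu> (space \<mu>) \<noteq> 0 \<and> emeasure \<mu> (space \<mu>) \<noteq> \<infinity> \<and>
          (\<forall>g\<in>carrier G. \<forall>A\<in>sets \<mu>. emeasure \<mu> ((\<lambda>X. g <#\<^bsub>G\<^esub> X) ` A) = emeasure \<mu> A))"


section \<open>Hermitian forms of signature (1,n) and the group PU(1,n)\<close>

definition hermitian_form :: "(complex^'m \<Rightarrow> complex^'m \<Rightarrow> complex) \<Rightarrow> bool" where
  "hermitian_form h \<longleftrightarrow>
     (\<forall>x y z. h (x + y) z = h x z + h y z) \<and>
     (\<forall>c x y. h (c *s x) y = c * h x y) \<and>
     (\<forall>x y. h y x = cnj (h x y))"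

definition signature_1_n :: "(complex^'m \<Rightarrow> complex^'m \<Rightarrow> complex) \<Rightarrow> nat \<Rightarrow> bool" where
  "signature_1_n h n \<longleftrightarrow>
     (\<exists>e :: nat \<Rightarrow> complex^'m. vec.span (e ` {..n}) = UNIV \<and>
        (\<forall>i\<le>n. \<forall>j\<le>n. h (e i) (e j) = (if i \<noteq> j then 0 else if i = 0 then 1 else - 1)))"

definition unitary_group :: "(complex^'m \<Rightarrow> complex^'m \<Rightarrow> complex) \<Rightarrow> (complex^'m^'m) monoid" where
  "unitary_group h =
     \<lparr>carrier = {g. \<forall>x y. h (g *v x) (g *v y) = h x y}, mult = (**), one = mat 1\<rparr>"

definition unit_scalars :: "(complex^'m^'m) set" where
  "unit_scalars = {mat c | c. cmod c = 1}"

definition PU :: "(complex^'m \<Rightarrow> complex^'m \<Rightarrow> complex) \<Rightarrow> (complex^'m^'m) set monoid" where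
  "PU h = unitary_group h Mod unit_scalars"

definition PU_topology ::
    "(complex^'m \<Rightarrow> complex^'m \<Rightarrow> complex) \<Rightarrow> (complex^'m^'m) set topology" where
  "PU_topology h =
     quotient_topology (top_of_set (carrier (unitary_group h)))
       (\<lambda>g. unit_scalars #>\<^bsub>unitary_group h\<^esub> g)"

abbreviation lattice_in_PU ::
    "(complex^'m \<Rightarrow> complex^'m \<Rightarrow> complex) \<Rightarrow> (complex^'m^'m) set set \<Rightarrow> bool" where
  "lattice_in_PU h \<equiv> lattice_subgroup (PU h) (PU_topology h)"

text \<open>The action of an element \<open>\<gamma>\<close> of \<open>PU h\<close>, i.e. of a coset of unitary matrices, on the complex
  subspaces of \<open>W\<close>: all representatives of \<open>\<gamma>\<close> have the same image on a complex subspace.\<close>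

definition act :: "(complex^'m^'m) set \<Rightarrow> (complex^'m) set \<Rightarrow> (complex^'m) set" where
  "act \<gamma> S = {g *v v | g v. g \<in> \<gamma> \<and> v \<in> S}"


section \<open>Cusps\<close>

definition complex_ball :: "(complex^'m \<Rightarrow> complex^'m \<Rightarrow> complex) \<Rightarrow> (complex^'m) set set" where
  "complex_ball h =
     {l. vec.subspace l \<and> vec.dim l = 1 \<and> (\<forall>v\<in>l. v \<noteq> 0 \<longrightarrow> Re (h v v) > 0)}"

definition isotropic_lines :: "(complex^'m \<Rightarrow> complex^'m \<Rightarrow> complex) \<Rightarrow> (complex^'m) set set" where
  "isotropic_lines h = {b. vec.subspace b \<and> vec.dim b = 1 \<and> (\<forall>v\<in>b. h v v = 0)}"

definition stabilizer_in ::
    "(complex^'m^'m) set set \<Rightarrow> (complex^'m) set \<Rightarrow> (complex^'m^'m) set set" where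
  "stabilizer_in \<Gamma> b = {\<gamma> \<in> \<Gamma>. act \<gamma> b = b}"

definition parabolic ::
    "(complex^'m \<Rightarrow> complex^'m \<Rightarrow> complex) \<Rightarrow> (complex^'m^'m) set \<Rightarrow> bool" where
  "parabolic h \<gamma> \<longleftrightarrow> \<gamma> \<in> carrier (PU h) \<and>
     (\<forall>l\<in>complex_ball h. act \<gamma> l \<noteq> l) \<and> (\<exists>!b. b \<in> isotropic_lines h \<and> act \<gamma> b = b)"

text \<open>A nontrivial stabilizer does not characterize cusps: a loxodromic element of \<open>\<Gamma>\<close> fixes two
  isotropic lines that are not cusps. The stabilizer of a cusp is required to contain a parabolic
  element.\<close>

definition cusps ::
    "(complex^'m \<Rightarrow> complex^'m \<Rightarrow> complex) \<Rightarrow> (complex^'m^'m) set set \<Rightarrow> (complex^'m) set set" where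
  "cusps h \<Gamma> = {b \<in> isotropic_lines h. \<exists>\<gamma>\<in>stabilizer_in \<Gamma> b. parabolic h \<gamma>}"

definition orth ::
    "(complex^'m \<Rightarrow> complex^'m \<Rightarrow> complex) \<Rightarrow> (complex^'m) set \<Rightarrow> (complex^'m) set" where
  "orth h b = {w. \<forall>v\<in>b. h w v = 0}"

text \<open>The affine space \<open>P(W/b) - P(b\<^sup>\<bottom>/b)\<close>. A line in \<open>W/b\<close> is given by its preimage in \<open>W\<close>, a
  plane containing \<open>b\<close>.\<close>

definition cusp_space ::
    "(complex^'m \<Rightarrow> complex^'m \<Rightarrow> complex) \<Rightarrow> (complex^'m) set \<Rightarrow> (complex^'m) set set" where
  "cusp_space h b =
     {P. vec.subspace P \<and> vec.dim P = 2 \<and> b \<subseteq> P \<and> \<not> P \<subseteq> orth h b}"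

text \<open>The translations of this affine space are given by \<open>Hom(W/b\<^sup>\<bottom>, b\<^sup>\<bottom>/b)\<close>; \<open>t\<close> below is (a lift
  of) an element of this space, viewed as an endomorphism of \<open>W\<close>. It moves the line \<open>b + \<complex>w\<close> of
  \<open>W/b\<close> to \<open>b + \<complex>(w + t w)\<close>.\<close>

definition acts_by_translation ::
    "(complex^'m \<Rightarrow> complex^'m \<Rightarrow> complex) \<Rightarrow> (complex^'m) set \<Rightarrow> (complex^'m^'m) set \<Rightarrow> bool" where
  "acts_by_translation h b \<gamma> \<longleftrightarrow>
     (\<exists>t :: complex^'m^'m. (\<forall>w. t *v w \<in> orth h b) \<and> (\<forall>w\<in>orth h b. t *v w = 0) \<and>
        (\<forall>P\<in>cusp_space h b. act \<gamma> P = (\<lambda>w. w + t *v w) ` P))"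

definition admissible_subgroup ::
    "(complex^'m \<Rightarrow> complex^'m \<Rightarrow> complex) \<Rightarrow>
     (complex^'m^'m) set set \<Rightarrow> (complex^'m^'m) set set \<Rightarrow> bool" where
  "admissible_subgroup h \<Gamma> \<Gamma>' \<longleftrightarrow>
     finite_index_subgroup (PU h) \<Gamma> \<Gamma>' \<and> torsion_free (PU h) \<Gamma>' \<and>
     (\<forall>b\<in>cusps h \<Gamma>'. \<forall>\<gamma>\<in>stabilizer_in \<Gamma>' b. acts_by_translation h b \<gamma>)"


section \<open>Complex tori, abelian varieties and isogenies\<close>

text \<open>The pair \<open>(V, \<Lambda>)\<close> stands for the complex torus \<open>V/\<Lambda>\<close>. Taking for \<open>V\<close> all complex
  subspaces of a fixed space covers all complex tori up to some dimension, including dimension 0.\<close>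

type_synonym 'm torus = "(complex^'m) set \<times> (complex^'m) set"

definition complex_torus :: "'m::finite torus \<Rightarrow> bool" where
  "complex_torus A \<longleftrightarrow> (case A of (V, \<Lambda>) \<Rightarrow>
     vec.subspace V \<and> 0 \<in> \<Lambda> \<and> (\<forall>x\<in>\<Lambda>. \<forall>y\<in>\<Lambda>. x - y \<in> \<Lambda>) \<and> discrete \<Lambda> \<and> span \<Lambda> = V)"

text \<open>A polarization: a positive definite Hermitian form on \<open>V\<close> whose imaginary part is integral
  on \<open>\<Lambda>\<close>.\<close>

definition riemann_form ::
    "'m::finite torus \<Rightarrow> (complex^'m \<Rightarrow> complex^'m \<Rightarrow> complex) \<Rightarrow> bool" where
  "riemann_form A H \<longleftrightarrow> (case A of (V, \<Lambda>) \<Rightarrow>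
     (\<forall>x\<in>V. \<forall>y\<in>V. \<forall>z\<in>V. H (x + y) z = H x z + H y z) \<and>
     (\<forall>c. \<forall>x\<in>V. \<forall>y\<in>V. H (c *s x) y = c * H x y) \<and>
     (\<forall>x\<in>V. \<forall>y\<in>V. H y x = cnj (H x y)) \<and>
     (\<forall>x\<in>V. x \<noteq> 0 \<longrightarrow> Re (H x x) > 0) \<and>
     (\<forall>x\<in>\<Lambda>. \<forall>y\<in>\<Lambda>. Im (H x y) \<in> \<int>))"

definition abelian_variety :: "'m::finite torus \<Rightarrow> bool" where
  "abelian_variety A \<longleftrightarrow> complex_torus A \<and> (\<exists>H. riemann_form A H)"

definition additive :: "'a::monoid_add set \<Rightarrow> 'a monoid" where
  "additive V = \<lparr>carrier = V, mult = (+), one = 0\<rparr>"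

definition torus_group :: "'m::finite torus \<Rightarrow> (complex^'m) set monoid" where
  "torus_group A = additive (fst A) Mod (snd A)"

definition torus_proj :: "'m::finite torus \<Rightarrow> complex^'m \<Rightarrow> (complex^'m) set" where
  "torus_proj A v = snd A #>\<^bsub>additive (fst A)\<^esub> v"

text \<open>A map of complex tori is holomorphic iff locally it has a holomorphic lift \<open>F\<close> to the
  universal covers. Derivatives are taken within the subspace \<open>fst A\<close>; the matrix \<open>D\<close> expresses
  that they are complex linear.\<close>

definition torus_holomorphic ::
    "'m::finite torus \<Rightarrow> 'm torus \<Rightarrow> ((complex^'m) set \<Rightarrow> (complex^'m) set) \<Rightarrow> bool" where
  "torus_holomorphic A B \<phi> \<longleftrightarrow>
     (\<forall>v\<in>fst A. \<exists>U F. open U \<and> v \<in> U \<and>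
        (\<forall>u\<in>U \<inter> fst A. F u \<in> fst B \<and> \<phi> (torus_proj A u) = torus_proj B (F u) \<and>
           (\<exists>D :: complex^'m^'m. (F has_derivative (\<lambda>w. D *v w)) (at u within fst A))))"

definition isogeny ::
    "'m::finite torus \<Rightarrow> 'm torus \<Rightarrow> ((complex^'m) set \<Rightarrow> (complex^'m) set) \<Rightarrow> bool" where
  "isogeny A B \<phi> \<longleftrightarrow>
     \<phi> \<in> hom (torus_group A) (torus_group B) \<and> torus_holomorphic A B \<phi> \<and>
     \<phi> ` carrier (torus_group A) = carrier (torus_group B) \<and>
     finite (kernel (torus_group A) (torus_group B) \<phi>)"

definition isogeny_class :: "'m::finite torus \<Rightarrow> 'm torus set" where
  "isogeny_class A = {B. abelian_variety B \<and> (\<exists>\<phi>. isogeny A B \<phi>)}"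


section \<open>The boundary abelian varieties\<close>

text \<open>The choice of an origin \<open>b + \<complex>w\<^sub>0\<close> and of a linear isomorphism \<open>V \<cong> b\<^sup>\<bottom>/b\<close>, lifted to
  \<open>L : V \<rightarrow> b\<^sup>\<bottom>\<close>, gives an affine isomorphism \<open>\<alpha>\<close> from \<open>V\<close> to \<open>P(W/b) - P(b\<^sup>\<bottom>/b)\<close>; bijectivity of
  \<open>\<alpha>\<close> amounts to bijectivity of \<open>V \<rightarrow> b\<^sup>\<bottom>/b\<close>.\<close>

definition affine_iso ::
    "(complex^'m \<Rightarrow> complex^'m \<Rightarrow> complex) \<Rightarrow> (complex^'m) set \<Rightarrow> (complex^'m) set \<Rightarrow>
     (complex^'m \<Rightarrow> (complex^'m) set) \<Rightarrow> bool" where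
  "affine_iso h b V \<alpha> \<longleftrightarrow>
     (\<exists>w0 (L :: complex^'m^'m). w0 \<notin> orth h b \<and> (\<forall>v\<in>V. L *v v \<in> orth h b) \<and>
        (\<forall>v\<in>V. \<alpha> v = vec.span (insert (w0 + L *v v) b))) \<and>
     bij_betw \<alpha> V (cusp_space h b)"

text \<open>The abelian varieties \<open>V/\<Lambda>\<close> isomorphic to \<open>D\<^sub>b = \<Gamma>\<^sub>b\<setminus>(P(W/b) - P(b\<^sup>\<bottom>/b))\<close> through such an
  \<open>\<alpha>\<close>, for some cusp \<open>b\<close>; cusps in the same \<open>\<Gamma>\<close>-orbit give the same abelian varieties. The last
  condition says that \<open>\<alpha>\<close> descends to a bijection from \<open>V/\<Lambda>\<close> to \<open>D\<^sub>b\<close>.\<close>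

definition boundary_abelian_varieties ::
    "(complex^'m \<Rightarrow> complex^'m \<Rightarrow> complex) \<Rightarrow> (complex^'m^'m) set set \<Rightarrow> 'm::finite torus set" where
  "boundary_abelian_varieties h \<Gamma> =
     {(V, \<Lambda>). abelian_variety (V, \<Lambda>) \<and>
        (\<exists>b\<in>cusps h \<Gamma>. \<exists>\<alpha>. affine_iso h b V \<alpha> \<and>
           (\<forall>u\<in>V. \<forall>v\<in>V. (\<exists>\<gamma>\<in>stabilizer_in \<Gamma> b. act \<gamma> (\<alpha> u) = \<alpha> v) \<longleftrightarrow> v - u \<in> \<Lambda>))}"

definition boundary_isogeny_classes ::
    "(complex^'m \<Rightarrow> complex^'m \<Rightarrow> complex) \<Rightarrow> (complex^'m^'m) set set \<Rightarrow> 'm::finite torus set set" where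
  "boundary_isogeny_classes h \<Gamma> = isogeny_class ` boundary_abelian_varieties h \<Gamma>"

end

theory Submission
  imports Defs
begin

text \<open>The idea is that a cusp, its affine chart and the translations acting on the chart can be
  compared element by element: taking powers moves an element of one lattice into the other, and
  the \<open>N\<close>-th power of a translation by \<open>v\<close> is the translation by \<open>N v\<close>.

  If \<open>\<Gamma>\<^sub>1\<close> and \<open>\<Gamma>\<^sub>2\<close> are commensurable, there are \<open>a \<in> PU(1,n)\<close> and exponents \<open>N\<close>, \<open>M\<close>, the
  same for all elements, such that \<open>a \<gamma>\<^sup>N a\<inverse> \<in> \<Gamma>\<^sub>2'\<close> for \<open>\<gamma> \<in> \<Gamma>\<^sub>1'\<close> and
  \<open>a\<inverse> \<delta>\<^sup>M a \<in> \<Gamma>\<^sub>1'\<close> for \<open>\<delta> \<in> \<Gamma>\<^sub>2'\<close> (\<open>commensurable_uniform_powers\<close>).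

  Let \<open>b\<close> be a cusp of \<open>\<Gamma>\<^sub>1'\<close>. That \<open>a b\<close> is a cusp of \<open>\<Gamma>\<^sub>2'\<close> requires that the \<open>N\<close>-th
  power of a parabolic element is parabolic. A parabolic element that acts by a translation at \<open>b\<close>
  has a representative in \<open>U(1,n)\<close> that is unipotent for the flag \<open>b \<subseteq> b\<^sup>\<bottom> \<subseteq> W\<close>
  (\<open>parabolic_translation_has_unipotent_lift\<close>). Such matrices are closed under products, and
  conversely they are parabolic unless their class in \<open>PU(1,n)\<close> is trivial
  (\<open>flag_unipotent_parabolic\<close>);
  torsion-freeness excludes trivial powers.

  Transport the affine chart at \<open>b\<close> by \<open>a\<close> to a chart at \<open>a b\<close> with the same vector space \<open>V\<close>. If
  \<open>\<Lambda>\<close> and \<open>\<Lambda>'\<close> are the groups of translations by which the two stabilizers act, then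
  \<open>N \<Lambda> \<subseteq> \<Lambda>'\<close> and \<open>M \<Lambda>' \<subseteq> \<Lambda>\<close>. Hence \<open>\<Lambda>'\<close> is again a polarized lattice in \<open>V\<close>
  (\<open>abelian_variety_if_commensurable\<close>), and multiplication by \<open>N\<close> and by \<open>M\<close> gives isogenies
  between \<open>V/\<Lambda>\<close> and \<open>V/\<Lambda>'\<close> in both directions, so that the isogeny classes agree
  (\<open>isogeny_class_eq_if_commensurable\<close>).\<close>

section \<open>Forms of Lorentzian signature\<close>

text \<open>A description of signature \<open>(1, n)\<close> without a basis: there is a positive vector whose orthogonal
  hyperplane is negative definite.\<close>

locale lorentzian_form =
  fixes h :: "complex^'m::finite \<Rightarrow> complex^'m \<Rightarrow> complex"
  assumes hermitian: "hermitian_form h"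
    and positive_axis:
      "\<exists>f. Re (h f f) > 0 \<and> (\<forall>x. h x f = 0 \<longrightarrow> x \<noteq> 0 \<longrightarrow> Re (h x x) < 0)"
begin

lemma form_add_left: "h (x + y) z = h x z + h y z"
  and form_scale_left: "h (c *s x) y = c * h x y"
  and form_cnj: "cnj (h x y) = h y x"
  using hermitian unfolding hermitian_form_def by metis+

lemma form_add_right: "h z (x + y) = h z x + h z y"
  by (metis form_add_left form_cnj complex_cnj_add)

lemma form_scale_right: "h x (c *s y) = cnj c * h x y"
  by (metis form_scale_left form_cnj complex_cnj_mult)

lemma form_zero_left [simp]: "h 0 y = 0"
  using form_scale_left[of 0 0 y] by simp

lemma form_zero_right [simp]: "h y 0 = 0"
  using form_scale_right[of y 0 0] by simp

lemma form_diff_left: "h (x - y) z = h x z - h y z"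
  using form_add_left[of "x - y" y z] by simp

lemma form_diff_right: "h z (x - y) = h z x - h z y"
  using form_add_right[of z "x - y" y] by simp

lemma form_eq_0_commute: "h x y = 0 \<longleftrightarrow> h y x = 0"
  by (metis form_cnj complex_cnj_zero_iff)

lemmas form_simps =
  form_add_left form_add_right form_scale_left form_scale_right form_diff_left form_diff_right

lemma nondegenerate:
  assumes "\<And>y. h x y = 0"
  shows "x = 0"
  using positive_axis assms by fastforce

lemma subspace_orth: "vec.subspace (orth h b)"
  unfolding vec.subspace_def orth_def by (auto simp: form_simps)

lemma isotropic_line_generator:
  assumes "b \<in> isotropic_lines h"
  obtains e where "e \<noteq> 0" "b = vec.span {e}" "h e e = 0" "e \<in> b"
proof -
  have b: "vec.subspace b" "vec.dim b = 1" "\<forall>v\<in>b. h v v = 0"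
    using assms by (auto simp: isotropic_lines_def)
  obtain B where B: "B \<subseteq> b" "vec.independent B" "b \<subseteq> vec.span B" "card B = 1"
    using vec.basis_exists[of b] b(2) by metis
  then obtain e where "B = {e}"
    using card_1_singletonE by blast
  moreover have "b = vec.span B"
    using B b(1) vec.span_minimal by blast
  ultimately show ?thesis
    using that[of e] B b(3) by (auto simp: vec.dependent_single)
qed

lemma orth_span_singleton: "x \<in> orth h (vec.span {e}) \<longleftrightarrow> h x e = 0"
proof
  assume "x \<in> orth h (vec.span {e})"
  then show "h x e = 0"
    unfolding orth_def using vec.span_superset by blast
next
  assume "h x e = 0"
  then show "x \<in> orth h (vec.span {e})"
    unfolding orth_def by (auto simp: vec.span_singleton form_simps)
qed

lemma isotropic_line_subset_orth:
  assumes "b \<in> isotropic_lines h"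
  shows "b \<subseteq> orth h b"
proof -
  obtain e where "e \<noteq> 0" "b = vec.span {e}" "h e e = 0" "e \<in> b"
    by (rule isotropic_line_generator[OF assms])
  then show ?thesis
    by (auto simp: orth_def vec.span_singleton form_simps)
qed

text \<open>If \<open>h x x \<ge> 0\<close>, the form would be positive semidefinite on the span of \<open>x\<close> and \<open>b\<close>. This
  plane meets the hyperplane orthogonal to the positive axis, where the form is negative
  definite.\<close>

lemma negative_on_orth:
  assumes b: "b \<in> isotropic_lines h" and x: "x \<in> orth h b" "x \<notin> b"
  shows "Re (h x x) < 0"
proof (rule ccontr)
  assume nonneg: "\<not> Re (h x x) < 0"
  obtain e where e: "e \<noteq> 0" "b = vec.span {e}" "h e e = 0"
    using isotropic_line_generator[OF b] by metis
  obtain f where f: "\<And>x. h x f = 0 \<Longrightarrow> x \<noteq> 0 \<Longrightarrow> Re (h x x) < 0"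
    using positive_axis by auto
  have xe: "h x e = 0" "h e x = 0"
    using x e orth_span_singleton form_eq_0_commute by blast+
  have ef: "h e f \<noteq> 0"
    using f[of e] e by auto
  define y where "y = h e f *s x - h x f *s e"
  have "h y y = (h e f * cnj (h e f)) * h x x"
    unfolding y_def by (simp add: form_simps xe e)
  also have "\<dots> = complex_of_real ((cmod (h e f))\<^sup>2) * h x x"
    by (metis complex_norm_square)
  finally have "Re (h y y) \<ge> 0"
    using nonneg by (simp add: zero_le_mult_iff)
  moreover have "h y f = 0"
    unfolding y_def by (simp add: form_simps)
  ultimately have "y = 0"
    using f[of y] by force
  then have "h e f *s x = h x f *s e"
    by (simp add: y_def)
  then have "x = (h x f / h e f) *s e"
    by (metis (no_types) ef divide_inverse mult.commute vec.scale_scale vec.scale_one left_inverse)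
  then show False
    using x e by (auto simp: vec.span_singleton)
qed

end

lemma lorentzian_form_if_signature:
  assumes h: "hermitian_form h" and sig: "signature_1_n h n"
  shows "lorentzian_form h"
proof
  show "hermitian_form h" by fact
  obtain e :: "nat \<Rightarrow> complex^'a" where span: "vec.span (e ` {..n}) = UNIV"
    and e: "\<And>i j. i \<le> n \<Longrightarrow> j \<le> n \<Longrightarrow> h (e i) (e j) = (if i \<noteq> j then 0 else if i = 0 then 1 else - 1)"
    using sig unfolding signature_1_n_def by auto
  have inj: "inj_on e {..n}"
  proof (rule inj_onI, rule ccontr)
    fix i j assume "i \<in> {..n}" "j \<in> {..n}" "e i = e j" "i \<noteq> j"
    then show False using e[of i j] e[of i i] by (auto split: if_splits)
  qed
  have add: "h (x + y) z = h x z + h y z" and scale: "h (c *s x) z = c * h x z"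
    and cnj: "h x y = cnj (h y x)" for c x y z
    using h unfolding hermitian_form_def by blast+
  have zero: "h 0 z = 0" for z
    using scale[of 0 0 z] by simp
  have sum: "h (\<Sum>i\<in>I. c i *s e i) z = (\<Sum>i\<in>I. c i * h (e i) z)" if "finite I" for I c z
    using that by (induction I rule: finite_induct) (auto simp: zero add scale)
  have neg: "Re (h x x) < 0" if x: "h x (e 0) = 0" "x \<noteq> 0" for x
  proof -
    obtain u where "x = (\<Sum>v\<in>e ` {..n}. u v *s v)"
      using span vec.span_finite[of "e ` {..n}"] by auto
    then obtain c where c: "x = (\<Sum>i\<le>n. c i *s e i)"
      using inj by (auto simp: sum.reindex)
    have coord: "h x (e j) = (if j = 0 then c j else - c j)" if "j \<le> n" for j
    proof -
      have "h x (e j) = (\<Sum>i\<le>n. c i * h (e i) (e j))"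
        unfolding c by (simp add: sum)
      also have "\<dots> = (\<Sum>i\<le>n. if i = j then (if j = 0 then c j else - c j) else 0)"
        using that e by (intro sum.cong) auto
      finally show ?thesis using that by simp
    qed
    have c0: "c 0 = 0" using coord[of 0] x by simp
    have "h x x = (\<Sum>i\<le>n. c i * h (e i) x)"
      by (subst (1) c) (simp add: sum)
    also have "\<dots> = (\<Sum>i\<le>n. - complex_of_real ((cmod (c i))\<^sup>2))"
    proof (intro sum.cong refl)
      fix i assume "i \<in> {..n}"
      then have "h (e i) x = (if i = 0 then cnj (c i) else - cnj (c i))"
        using cnj[of "e i" x] coord[of i] by simp
      then show "c i * h (e i) x = - complex_of_real ((cmod (c i))\<^sup>2)"
        using c0 by (simp add: complex_norm_square[symmetric])
    qed
    finally have "Re (h x x) = - (\<Sum>i\<le>n. (cmod (c i))\<^sup>2)"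
      by (simp add: sum_negf)
    moreover have "(\<Sum>i\<le>n. (cmod (c i))\<^sup>2) > 0"
    proof (rule ccontr)
      assume "\<not> ?thesis"
      then have "(\<Sum>i\<le>n. (cmod (c i))\<^sup>2) = 0"
        by (meson antisym_conv2 sum_nonneg zero_le_power2 linorder_not_less order_antisym)
      then have "\<forall>i\<le>n. c i = 0"
        by (simp add: sum_nonneg_eq_0_iff)
      then show False using c x(2) by simp
    qed
    ultimately show ?thesis by simp
  qed
  have "Re (h (e 0) (e 0)) > 0"
    using e[of 0 0] by simp
  then show "\<exists>f. Re (h f f) > 0 \<and> (\<forall>x. h x f = 0 \<longrightarrow> x \<noteq> 0 \<longrightarrow> Re (h x x) < 0)"
    using neg by blast
qed


section \<open>The projective unitary group and its action on subspaces\<close>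

lemma mat_vector_mult [simp]: "mat c *v x = (c::complex) *s x"
  unfolding vec_eq_iff matrix_vector_mult_def mat_def
  by (simp add: if_distrib if_distribR cong del: if_weak_cong)

lemma dim_line: "w \<noteq> 0 \<Longrightarrow> vec.dim (vec.span {w}) = 1"
  using vec.dim_eq_card_independent[of "{w}"] by (simp add: vec.dependent_single)

lemma mat_mult_mat: "mat a ** mat b = (mat (a * b) :: complex^'m^'m)"
  unfolding matrix_eq by (simp add: matrix_vector_mul_assoc[symmetric])

context lorentzian_form
begin

abbreviation "UG \<equiv> unitary_group h"

lemma unitary_iff: "g \<in> carrier UG \<longleftrightarrow> (\<forall>x y. h (g *v x) (g *v y) = h x y)"
  by (simp add: unitary_group_def)

lemma unitary_mult [simp]: "g \<otimes>\<^bsub>UG\<^esub> k = g ** k"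
  and unitary_one [simp]: "\<one>\<^bsub>UG\<^esub> = mat 1"
  by (simp_all add: unitary_group_def)

lemma group_unitary: "group UG"
proof (rule groupI)
  fix g assume g: "g \<in> carrier UG"
  have "x = 0" if "g *v x = 0" for x
  proof (rule nondegenerate)
    fix y
    have "h x y = h (g *v x) (g *v y)" using g by (simp add: unitary_iff)
    then show "h x y = 0" using that by simp
  qed
  then obtain k where k: "k ** g = mat 1"
    using matrix_left_invertible_ker[of g] by auto
  then have gk: "g ** k = mat 1"
    by (simp add: matrix_left_right_inverse)
  have "h (k *v x) (k *v y) = h (g *v (k *v x)) (g *v (k *v y))" for x y
    using g by (simp add: unitary_iff)
  then have "k \<in> carrier UG"
    by (simp add: unitary_iff matrix_vector_mul_assoc gk)
  with k show "\<exists>k\<in>carrier UG. k \<otimes>\<^bsub>UG\<^esub> g = \<one>\<^bsub>UG\<^esub>"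
    by auto
qed (auto simp: unitary_iff matrix_vector_mul_assoc[symmetric] matrix_mul_assoc)

sublocale UG: group UG by (rule group_unitary)

lemma unit_scalar_unitary:
  assumes "cmod c = 1"
  shows "mat c \<in> carrier UG"
proof -
  have "c * cnj c = 1"
    using assms complex_norm_square[of c] by simp
  then show ?thesis
    by (simp add: unitary_iff form_simps mult.assoc[symmetric] mult.commute[of "cnj c"])
qed

lemma scalar_commute: "mat c ** g = g ** (mat c :: complex^'m^'m)"
  unfolding matrix_eq
  by (simp add: matrix_vector_mul_assoc[symmetric] vec.scale)

lemma normal_unit_scalars: "unit_scalars \<lhd> UG"
proof (rule UG.normal_invI)
  show "subgroup unit_scalars UG"
  proof (rule UG.subgroupI)
    show "unit_scalars \<subseteq> carrier UG"
      by (auto simp: unit_scalars_def unit_scalar_unitary)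
    show "unit_scalars \<noteq> {}"
      by (auto simp: unit_scalars_def intro: exI[of _ "1::complex"])
    fix g :: "complex^'m^'m" assume "g \<in> unit_scalars"
    then obtain c where c: "g = mat c" "cmod c = 1"
      by (auto simp: unit_scalars_def)
    then have "mat (inverse c) ** mat c = (mat 1 :: complex^'m^'m)"
      by (simp add: mat_mult_mat) (metis c(2) left_inverse norm_zero zero_neq_one)
    then have "inv\<^bsub>UG\<^esub> g = mat (inverse c)"
      using c by (intro UG.inv_equality) (auto simp: unit_scalar_unitary norm_inverse)
    then show "inv\<^bsub>UG\<^esub> g \<in> unit_scalars"
      using c by (auto simp: unit_scalars_def norm_inverse intro!: exI[of _ "inverse c"])
  next
    fix g k :: "complex^'m^'m" assume "g \<in> unit_scalars" "k \<in> unit_scalars"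
    then obtain c d where "g = mat c" "k = mat d" "cmod c = 1" "cmod d = 1"
      by (auto simp: unit_scalars_def)
    then show "g \<otimes>\<^bsub>UG\<^esub> k \<in> unit_scalars"
      by (auto simp: unit_scalars_def mat_mult_mat norm_mult intro!: exI[of _ "c * d"])
  qed
next
  fix g s :: "complex^'m^'m" assume g: "g \<in> carrier UG" and "s \<in> unit_scalars"
  then obtain c where c: "s = mat c" "cmod c = 1"
    by (auto simp: unit_scalars_def)
  have "g \<otimes>\<^bsub>UG\<^esub> s = s \<otimes>\<^bsub>UG\<^esub> g"
    by (simp add: c scalar_commute)
  then have "g \<otimes>\<^bsub>UG\<^esub> s \<otimes>\<^bsub>UG\<^esub> inv\<^bsub>UG\<^esub> g = s"
    using g c unit_scalar_unitary by (metis UG.inv_solve_right' UG.m_closed)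
  then show "g \<otimes>\<^bsub>UG\<^esub> s \<otimes>\<^bsub>UG\<^esub> inv\<^bsub>UG\<^esub> g \<in> unit_scalars"
    using \<open>s \<in> unit_scalars\<close> by simp
qed

lemma group_PU: "group (PU h)"
  unfolding PU_def by (rule normal.factorgroup_is_group[OF normal_unit_scalars])

sublocale PU: group "PU h" by (rule group_PU)

definition proj :: "complex^'m^'m \<Rightarrow> (complex^'m^'m) set" where
  "proj g = {mat c ** g | c. cmod c = 1}"

lemma proj_eq_coset: "proj g = unit_scalars #>\<^bsub>UG\<^esub> g"
  by (auto simp: proj_def r_coset_def unit_scalars_def)

lemma carrier_PU: "carrier (PU h) = proj ` carrier UG"
  by (auto simp: PU_def carrier_FactGroup proj_eq_coset)

lemma proj_closed [intro]: "g \<in> carrier UG \<Longrightarrow> proj g \<in> carrier (PU h)"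
  by (simp add: carrier_PU)

lemma proj_mult:
  "g \<in> carrier UG \<Longrightarrow> k \<in> carrier UG \<Longrightarrow> proj g \<otimes>\<^bsub>PU h\<^esub> proj k = proj (g ** k)"
  using normal.rcos_sum[OF normal_unit_scalars, of g k]
  by (simp add: PU_def proj_eq_coset)

lemma proj_one: "proj (mat 1) = \<one>\<^bsub>PU h\<^esub>"
  by (auto simp: PU_def proj_def unit_scalars_def)

lemma proj_scalar:
  assumes "cmod c = 1"
  shows "proj (mat c ** g) = proj g"
proof -
  have c0: "c \<noteq> 0" using assms by auto
  have "\<exists>d. mat a ** g = mat d ** (mat c ** g) \<and> cmod d = 1" if "cmod a = 1" for a
    using that assms c0
    by (intro exI[of _ "a / c"]) (simp add: matrix_mul_assoc mat_mult_mat norm_divide)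
  moreover have "\<exists>d. mat a ** (mat c ** g) = mat d ** g \<and> cmod d = 1" if "cmod a = 1" for a
    using that assms
    by (intro exI[of _ "a * c"]) (simp add: matrix_mul_assoc mat_mult_mat norm_mult)
  ultimately show ?thesis
    unfolding proj_def by blast
qed

lemma act_proj:
  assumes "vec.subspace S"
  shows "act (proj g) S = (*v) g ` S"
proof
  show "act (proj g) S \<subseteq> (*v) g ` S"
  proof
    fix y assume "y \<in> act (proj g) S"
    then obtain c v where "y = mat c ** g *v v" "v \<in> S"
      by (auto simp: act_def proj_def)
    then have "y = g *v (c *s v)" "c *s v \<in> S"
      using assms by (auto simp: matrix_vector_mul_assoc[symmetric] vec.scale vec.subspace_scale)
    then show "y \<in> (*v) g ` S" by blast
  qed
  have "g \<in> proj g"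
    unfolding proj_def by (rule CollectI, rule exI[of _ 1]) simp
  then show "(*v) g ` S \<subseteq> act (proj g) S"
    by (auto simp: act_def)
qed

lemma act_one: "vec.subspace S \<Longrightarrow> act \<one>\<^bsub>PU h\<^esub> S = S"
  by (simp add: proj_one[symmetric] act_proj)

lemma subspace_act:
  assumes "\<gamma> \<in> carrier (PU h)" "vec.subspace S"
  shows "vec.subspace (act \<gamma> S)"
  using assms by (auto simp: carrier_PU act_proj vec.subspace_image)

lemma act_mult:
  assumes "\<gamma> \<in> carrier (PU h)" "\<delta> \<in> carrier (PU h)" "vec.subspace S"
  shows "act (\<gamma> \<otimes>\<^bsub>PU h\<^esub> \<delta>) S = act \<gamma> (act \<delta> S)"
proof -
  obtain g k where "g \<in> carrier UG" "\<gamma> = proj g" "k \<in> carrier UG" "\<delta> = proj k"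
    using assms by (auto simp: carrier_PU)
  then show ?thesis
    using assms(3) by (simp add: proj_mult act_proj vec.subspace_image image_image
        matrix_vector_mul_assoc)
qed

lemma act_inv_cancel:
  assumes "\<gamma> \<in> carrier (PU h)" "vec.subspace S"
  shows "act (inv\<^bsub>PU h\<^esub> \<gamma>) (act \<gamma> S) = S" "act \<gamma> (act (inv\<^bsub>PU h\<^esub> \<gamma>) S) = S"
  using assms by (simp_all add: act_mult[symmetric] act_one)

lemma unitary_inj:
  assumes "g \<in> carrier UG"
  shows "inj ((*v) g)"
proof -
  obtain k where "k \<otimes>\<^bsub>UG\<^esub> g = \<one>\<^bsub>UG\<^esub>"
    using assms by (meson UG.l_inv_ex)
  then show ?thesis
    using matrix_left_invertible_injective by auto
qed

lemma dim_act:
  assumes "\<gamma> \<in> carrier (PU h)" "vec.subspace S"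
  shows "vec.dim (act \<gamma> S) = vec.dim S"
proof -
  obtain g where "g \<in> carrier UG" "\<gamma> = proj g"
    using assms by (auto simp: carrier_PU)
  then show ?thesis
    using assms(2) unitary_inj[of g]
    by (simp add: act_proj vec.dim_image_eq inj_on_subset)
qed

lemma act_isotropic:
  assumes "\<gamma> \<in> carrier (PU h)" "b \<in> isotropic_lines h"
  shows "act \<gamma> b \<in> isotropic_lines h"
proof -
  obtain g where g: "g \<in> carrier UG" "\<gamma> = proj g"
    using assms by (auto simp: carrier_PU)
  have "vec.subspace b" using assms(2) by (simp add: isotropic_lines_def)
  then show ?thesis
    using assms subspace_act[OF assms(1)] dim_act[OF assms(1)] g
    by (auto simp: isotropic_lines_def act_proj unitary_iff)
qed

lemma act_ball:
  assumes "\<gamma> \<in> carrier (PU h)" "l \<in> complex_ball h"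
  shows "act \<gamma> l \<in> complex_ball h"
proof -
  obtain g where g: "g \<in> carrier UG" "\<gamma> = proj g"
    using assms by (auto simp: carrier_PU)
  have l: "vec.subspace l" using assms(2) by (simp add: complex_ball_def)
  have "Re (h y y) > 0" if y: "y \<in> act \<gamma> l" "y \<noteq> 0" for y
  proof -
    obtain v where "v \<in> l" "y = g *v v"
      using y g l by (auto simp: act_proj)
    then show ?thesis
      using assms(2) y g by (cases "v = 0") (auto simp: complex_ball_def unitary_iff)
  qed
  then show ?thesis
    using assms(2) subspace_act[OF assms(1) l] dim_act[OF assms(1) l]
    by (auto simp: complex_ball_def)
qed

lemma orth_act:
  assumes "g \<in> carrier UG" "vec.subspace b"
  shows "g *v x \<in> orth h (act (proj g) b) \<longleftrightarrow> x \<in> orth h b"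
  using assms by (auto simp: act_proj orth_def unitary_iff)

end


context lorentzian_form
begin

section \<open>Parabolic and unipotent elements\<close>

text \<open>The matrix acts as the identity on the graded pieces of the flag \<open>b \<subseteq> b\<^sup>\<bottom> \<subseteq> W\<close>. Unlike
  parabolicity, this is visibly stable under products.\<close>

definition flag_unipotent :: "(complex^'m) set \<Rightarrow> complex^'m^'m \<Rightarrow> bool" where
  "flag_unipotent b g \<longleftrightarrow> (\<forall>x\<in>b. g *v x = x) \<and>
     (\<forall>x\<in>orth h b. g *v x - x \<in> b) \<and> (\<forall>x. g *v x - x \<in> orth h b)"

lemma flag_unipotent_one: "vec.subspace b \<Longrightarrow> flag_unipotent b (mat 1)"
  unfolding flag_unipotent_def by (simp add: vec.subspace_0 subspace_orth)

lemma flag_unipotent_mult: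
  assumes b: "b \<in> isotropic_lines h" and g: "flag_unipotent b g" and k: "flag_unipotent b k"
  shows "flag_unipotent b (g ** k)"
proof -
  have sub: "vec.subspace b" using b by (simp add: isotropic_lines_def)
  have split: "g ** k *v x - x = (g *v (k *v x) - k *v x) + (k *v x - x)" for x
    by (simp add: matrix_vector_mul_assoc)
  have bo: "b \<subseteq> orth h b" by (rule isotropic_line_subset_orth[OF b])
  have "k *v x \<in> orth h b" if "x \<in> orth h b" for x
  proof -
    have "k *v x = (k *v x - x) + x" by simp
    then show ?thesis
      using k that bo vec.subspace_add[OF subspace_orth, of "k *v x - x" b x]
      by (auto simp: flag_unipotent_def)
  qed
  then have "g ** k *v x - x \<in> b" if "x \<in> orth h b" for x
    unfolding split using that g k by (intro vec.subspace_add[OF sub]) (auto simp: flag_unipotent_def)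
  moreover have "g ** k *v x - x \<in> orth h b" for x
    unfolding split using g k
    by (intro vec.subspace_add[OF subspace_orth]) (auto simp: flag_unipotent_def)
  ultimately show ?thesis
    using g k by (auto simp: flag_unipotent_def matrix_vector_mul_assoc[symmetric])
qed

lemma flag_unipotent_pow:
  assumes b: "b \<in> isotropic_lines h" and g: "g \<in> carrier UG" "flag_unipotent b g"
  shows "\<exists>k\<in>carrier UG. flag_unipotent b k \<and> proj g [^]\<^bsub>PU h\<^esub> (N::nat) = proj k"
proof (induction N)
  case 0
  have "flag_unipotent b (mat 1)"
    using b by (intro flag_unipotent_one) (simp add: isotropic_lines_def)
  moreover have "mat 1 \<in> carrier UG"
    using UG.one_closed by simp
  ultimately show ?case
    using proj_one by (intro bexI[of _ "mat 1"]) simp_all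
next
  case (Suc N)
  then obtain k where k: "k \<in> carrier UG" "flag_unipotent b k" "proj g [^]\<^bsub>PU h\<^esub> N = proj k"
    by blast
  then have "k ** g \<in> carrier UG"
    using UG.m_closed[of k g] g by simp
  then show ?case
    using k g flag_unipotent_mult[OF b] by (intro bexI[of _ "k ** g"]) (auto simp: proj_mult)
qed

text \<open>If \<open>v\<close> is not orthogonal to \<open>b\<close>, then every \<open>x\<close> differs from a multiple of \<open>v\<close> by a vector of
  \<open>b\<^sup>\<bottom>\<close>, so \<open>g x - x \<in> b\<close>. As \<open>h (g x) (g v) = h x v\<close>, this difference is orthogonal to \<open>v\<close> and
  therefore zero.\<close>

lemma flag_unipotent_fixed_vector:
  assumes b: "b \<in> isotropic_lines h" and g: "g \<in> carrier UG" "flag_unipotent b g"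
    and ne: "proj g \<noteq> \<one>\<^bsub>PU h\<^esub>" and v: "g *v v = v"
  shows "v \<in> orth h b"
proof (rule ccontr)
  assume v': "v \<notin> orth h b"
  obtain e where e: "e \<noteq> 0" "b = vec.span {e}" "h e e = 0" "e \<in> b"
    by (rule isotropic_line_generator[OF b])
  have ve: "h v e \<noteq> 0" "h e v \<noteq> 0"
    using v' e form_eq_0_commute by (auto simp: orth_span_singleton)
  have "g *v x = x" for x
  proof -
    define y where "y = x - (h x e / h v e) *s v"
    have "y \<in> orth h b"
      using ve by (simp add: e orth_span_singleton y_def form_simps)
    then have "g *v y - y \<in> b"
      using g by (simp add: flag_unipotent_def)
    moreover have "g *v y - y = g *v x - x"
      by (simp add: y_def matrix_vector_mult_diff_distrib vec.scale v)
    ultimately obtain s where s: "g *v x - x = s *s e"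
      by (auto simp: e(2) vec.span_singleton)
    have "h (g *v x) (g *v v) = h x v"
      using g by (simp add: unitary_iff)
    then have "h (g *v x - x) v = 0"
      by (simp add: v form_simps)
    then have "s = 0" using s ve by (simp add: form_simps)
    then show ?thesis using s by simp
  qed
  then have "g = mat 1"
    by (simp add: matrix_eq)
  then show False using ne proj_one by simp
qed

text \<open>A generator \<open>v\<close> of a fixed line lies in \<open>b\<^sup>\<bottom>\<close>: this holds for eigenvalue 1 by the previous lemma,
  and for other eigenvalues because \<open>g\<close> is the identity on \<open>W/b\<^sup>\<bottom>\<close>. On \<open>b\<^sup>\<bottom>\<close> the form is negative
  outside \<open>b\<close>. This excludes positive fixed lines and isotropic ones other than \<open>b\<close>.\<close>

lemma flag_unipotent_fixed_line:
  assumes b: "b \<in> isotropic_lines h" and g: "g \<in> carrier UG" "flag_unipotent b g"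
    and ne: "proj g \<noteq> \<one>\<^bsub>PU h\<^esub>"
    and l: "vec.subspace l" "act (proj g) l = l" and v: "v \<in> l" "v \<noteq> 0" "vec.dim l = 1"
    and nonneg: "Re (h v v) \<ge> 0"
  shows "v \<in> b"
proof -
  obtain B where B: "B \<subseteq> l" "vec.independent B" "l \<subseteq> vec.span B" "card B = 1"
    using vec.basis_exists[of l] v(3) by metis
  then obtain w where "B = {w}"
    using card_1_singletonE by blast
  then obtain a where a: "v = a *s w"
    using v B by (auto simp: vec.span_singleton)
  have "g *v v \<in> l"
    using l v by (auto simp: act_proj)
  then obtain a' where a': "g *v v = a' *s w"
    using B \<open>B = {w}\<close> by (auto simp: vec.span_singleton)
  have "a \<noteq> 0" using v a by auto
  then have mu: "g *v v = (a' / a) *s v"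
    unfolding a' using a by simp
  define \<mu> where "\<mu> = a' / a"
  have mu: "g *v v - v = (\<mu> - 1) *s v"
    using mu unfolding \<mu>_def by (simp add: vec.scale_left_diff_distrib)
  have in_orth: "v \<in> orth h b"
  proof (cases "\<mu> = 1")
    case True
    then show ?thesis
      using mu flag_unipotent_fixed_vector[OF b g ne, of v] by simp
  next
    case False
    have "(\<mu> - 1) *s v \<in> orth h b"
      using g mu[symmetric] by (simp add: flag_unipotent_def)
    then have "inverse (\<mu> - 1) *s ((\<mu> - 1) *s v) \<in> orth h b"
      by (rule vec.subspace_scale[OF subspace_orth])
    then show ?thesis using False unfolding vec.scale_scale by simp
  qed
  then show ?thesis
    using negative_on_orth[OF b, of v] nonneg by force
qed

lemma isotropic_lines_eqI:
  assumes "b \<in> isotropic_lines h" "b' \<in> isotropic_lines h" "v \<in> b" "v \<in> b'" "v \<noteq> 0"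
  shows "b = b'"
proof -
  have "c = vec.span {v}" if c: "c \<in> isotropic_lines h" "v \<in> c" for c
  proof -
    obtain e where e: "c = vec.span {e}"
      using isotropic_line_generator[OF c(1)] by metis
    then obtain a where a: "v = a *s e"
      using c by (auto simp: vec.span_singleton)
    then have "e = inverse a *s v" "a \<noteq> 0"
      using assms(5) by auto
    then have "e \<in> vec.span {v}"
      by (auto simp: vec.span_singleton)
    then show ?thesis
      using e c(2) vec.span_minimal[of "{e}" "vec.span {v}"] vec.span_minimal[of "{v}" c] by auto
  qed
  then show ?thesis using assms by metis
qed

lemma flag_unipotent_parabolic:
  assumes b: "b \<in> isotropic_lines h" and g: "g \<in> carrier UG" "flag_unipotent b g"
    and ne: "proj g \<noteq> \<one>\<^bsub>PU h\<^esub>"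
  shows "parabolic h (proj g)"
  unfolding parabolic_def
proof (intro conjI ballI)
  show "proj g \<in> carrier (PU h)" using g by blast
  have nonzero: "\<exists>v\<in>l. v \<noteq> 0" if "vec.dim l = 1" for l :: "(complex^'m) set"
  proof (rule ccontr)
    assume "\<not> ?thesis"
    then have "l \<subseteq> {0}" by blast
    then have "vec.dim l = 0" by (simp add: vec.dim_eq_0)
    then show False using that by simp
  qed
  fix l assume l: "l \<in> complex_ball h"
  show "act (proj g) l \<noteq> l"
  proof
    assume fixed: "act (proj g) l = l"
    obtain v where v: "v \<in> l" "v \<noteq> 0"
      using nonzero l by (auto simp: complex_ball_def)
    then have pos: "Re (h v v) > 0"
      using l by (auto simp: complex_ball_def)
    then have "v \<in> b"
      using l v fixed by (intro flag_unipotent_fixed_line[OF b g ne, of l]) (auto simp: complex_ball_def)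
    then show False
      using pos b by (auto simp: isotropic_lines_def)
  qed
next
  have sub: "vec.subspace b" using b by (simp add: isotropic_lines_def)
  have "(*v) g ` b = id ` b"
    using g by (intro image_cong) (auto simp: flag_unipotent_def)
  then have fixed: "act (proj g) b = b"
    using sub by (simp add: act_proj)
  moreover have "b' = b" if b': "b' \<in> isotropic_lines h" "act (proj g) b' = b'" for b'
  proof -
    obtain v where v: "v \<noteq> 0" "v \<in> b'"
      using isotropic_line_generator[OF b'(1)] by metis
    then have "v \<in> b"
      using b' by (intro flag_unipotent_fixed_line[OF b g ne, of b']) (auto simp: isotropic_lines_def)
    then show ?thesis
      using isotropic_lines_eqI b b' v by blast
  qed
  ultimately show "\<exists>!b. b \<in> isotropic_lines h \<and> act (proj g) b = b"
    using b by blast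
qed

text \<open>The translation condition says that a representative \<open>g\<close> acts on \<open>W/b\<close> as \<open>c (1 + t)\<close>. On
  \<open>b\<close> it is the scalar \<open>inverse (cnj c)\<close>. If \<open>b\<close> is a proper subspace of \<open>b\<^sup>\<bottom>\<close>, the definite form on
  \<open>b\<^sup>\<bottom>/b\<close> gives \<open>\<bar>c\<bar> = 1\<close>; if \<open>b = b\<^sup>\<bottom>\<close> and \<open>\<bar>c\<bar> \<noteq> 1\<close>, then \<open>g\<close> has an eigenvector for \<open>c\<close>, which spans
  a second fixed isotropic line. So \<open>g / c\<close> is a unipotent representative.\<close>

lemma parabolic_translation_has_unipotent_lift:
  assumes b: "b \<in> isotropic_lines h" and par: "parabolic h \<gamma>" and fixed: "act \<gamma> b = b"
    and tr: "acts_by_translation h b \<gamma>"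
  shows "\<exists>g\<in>carrier UG. \<gamma> = proj g \<and> flag_unipotent b g"
proof -
  obtain g where g: "g \<in> carrier UG" "\<gamma> = proj g"
    using par by (auto simp: parabolic_def carrier_PU)
  have sub: "vec.subspace b" using b by (simp add: isotropic_lines_def)
  obtain e where e: "e \<noteq> 0" "b = vec.span {e}" "h e e = 0" "e \<in> b"
    by (rule isotropic_line_generator[OF b])
  obtain t :: "complex^'m^'m" where "(\<forall>w. t *v w \<in> orth h b) \<and> (\<forall>w\<in>orth h b. t *v w = 0) \<and>
      (\<forall>P\<in>cusp_space h b. act \<gamma> P = (\<lambda>w. w + t *v w) ` P)"
    using tr unfolding acts_by_translation_def by meson
  then have t: "\<And>w. t *v w \<in> orth h b" "\<And>w. w \<in> orth h b \<Longrightarrow> t *v w = 0"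
    and act_t: "\<And>P. P \<in> cusp_space h b \<Longrightarrow> act \<gamma> P = (\<lambda>w. w + t *v w) ` P"
    by simp_all
  have te: "h (t *v w) e = 0" for w
    using t(1)[of w] by (simp add: e(2) orth_span_singleton)
  then have te': "h e (t *v w) = 0" for w
    using form_eq_0_commute by blast
  have unitary: "h (g *v x) (g *v y) = h x y" for x y
    using g by (simp add: unitary_iff)
  \<comment> \<open>The factor \<open>c\<close> depends on \<open>w\<close> a priori. It turns out to be constant by comparing \<open>w0\<close> with
    \<open>w0 + x\<close> for \<open>x \<in> b\<^sup>\<bottom>\<close>, since \<open>g\<close> preserves \<open>b\<^sup>\<bottom>\<close>.\<close>
  have off: "\<exists>c s. g *v w = c *s (w + t *v w) + s *s e" if w: "w \<notin> orth h b" for w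
  proof -
    have indep: "w \<notin> b" using w isotropic_line_subset_orth[OF b] by blast
    have "vec.independent {w, e}"
      using e indep by (simp add: vec.independent_insert)
    moreover have "w \<noteq> e" using indep e by blast
    ultimately have "vec.dim (vec.span {w, e}) = 2"
      by (simp add: vec.dim_eq_card_independent)
    moreover have "b \<subseteq> vec.span {w, e}"
      unfolding e(2) by (intro vec.span_mono) auto
    moreover have "w \<in> vec.span {w, e}" by (simp add: vec.span_base)
    ultimately have P: "vec.span {w, e} \<in> cusp_space h b"
      using w by (auto simp: cusp_space_def)
    have "g *v w \<in> act \<gamma> (vec.span {w, e})"
      using \<open>w \<in> vec.span {w, e}\<close> by (auto simp: g act_proj)
    then obtain u where u: "u \<in> vec.span {w, e}" "g *v w = u + t *v u"
      using act_t[OF P] by auto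
    obtain c s where "u = c *s w + s *s e"
    proof -
      obtain c where "u - c *s w \<in> vec.span {e}"
        using u(1) by (auto simp: vec.span_insert)
      then obtain s where "u - c *s w = s *s e"
        by (auto simp: vec.span_singleton)
      then have "u = c *s w + s *s e" by (simp add: diff_eq_eq add.commute)
      then show thesis by (rule that)
    qed
    moreover have "t *v e = 0" using t(2) e isotropic_line_subset_orth[OF b] by blast
    ultimately have "g *v w = c *s (w + t *v w) + s *s e"
      using u(2) by (simp add: matrix_vector_right_distrib vec.scale vec.scale_right_distrib algebra_simps)
    then show ?thesis by blast
  qed
  have "g *v e \<in> b" using fixed e sub by (auto simp: g act_proj)
  then obtain \<nu> where l: "g *v e = \<nu> *s e"
    by (auto simp: e(2) vec.span_singleton)
  have "g *v e \<noteq> 0"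
    using unitary_inj[OF g(1)] e(1) by (metis injD matrix_vector_mult_0_right)
  then have l0: "\<nu> \<noteq> 0" using l by auto
  have orth_g: "h (g *v x) e = 0" if "h x e = 0" for x
  proof -
    have "h (g *v x) (\<nu> *s e) = 0"
      using unitary[of x e] that by (simp add: l)
    then show ?thesis using l0 by (simp add: form_simps)
  qed
  obtain w0 where w0: "h w0 e \<noteq> 0"
    using nondegenerate[of e] e form_eq_0_commute by blast
  then obtain c s0 where c: "g *v w0 = c *s (w0 + t *v w0) + s0 *s e"
    using off[of w0] by (auto simp: e(2) orth_span_singleton)
  have on_orth: "\<exists>s. g *v x = c *s x + s *s e" if x: "h x e = 0" for x
  proof -
    have "w0 + x \<notin> orth h b"
      using w0 x by (simp add: e(2) orth_span_singleton form_simps)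
    then obtain c' s' where c': "g *v (w0 + x) = c' *s (w0 + x + t *v (w0 + x)) + s' *s e"
      using off by blast
    have "t *v x = 0" using x t(2) by (simp add: e(2) orth_span_singleton)
    then have gx: "g *v x = c' *s (w0 + x + t *v w0) + s' *s e - c *s (w0 + t *v w0) - s0 *s e"
      using c' c by (simp add: matrix_vector_right_distrib algebra_simps)
    have "h (g *v x) e = c' * h w0 e - c * h w0 e"
      unfolding gx by (simp add: form_simps te e x)
    then have "c' = c" using orth_g[OF x] w0 by simp
    then have "g *v x = c *s x + (s' - s0) *s e"
      unfolding gx by (simp add: vec.scale_right_distrib vec.scale_left_diff_distrib)
    then show ?thesis by blast
  qed
  have lc: "\<nu> * cnj c = 1"
  proof -
    have "h (g *v e) (g *v w0) = h e w0" by (rule unitary)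
    moreover have "h e w0 \<noteq> 0" using w0 form_eq_0_commute by blast
    ultimately show ?thesis by (simp add: l c form_simps te' e mult.commute)
  qed
  have norm_c: "c * cnj c = 1"
  proof (cases "\<exists>x. h x e = 0 \<and> x \<notin> b")
    case True
    then obtain x where x: "h x e = 0" "x \<notin> b" by blast
    then have xe: "h e x = 0" using form_eq_0_commute by blast
    have "h x x \<noteq> 0"
      using negative_on_orth[OF b, of x] x by (auto simp: e(2) orth_span_singleton)
    obtain s where "g *v x = c *s x + s *s e" using on_orth x by blast
    then have "h x x = (c * cnj c) * h x x"
      using unitary[of x x] x xe e by (simp add: form_simps algebra_simps)
    then show ?thesis using \<open>h x x \<noteq> 0\<close> by simp
  next
    case False
    show ?thesis
    proof (rule ccontr)
      assume nc: "c * cnj c \<noteq> 1"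
      then have cl: "c \<noteq> \<nu>" using lc by auto
      have "t *v w0 \<in> b" using False te by blast
      then obtain r where r: "t *v w0 = r *s e" by (auto simp: e(2) vec.span_singleton)
      define s where "s = c * r + s0"
      have gw: "g *v w0 = c *s w0 + s *s e"
        unfolding s_def c r by (simp add: vec.scale_right_distrib vec.scale_left_distrib)
      define w where "w = w0 + (s / (c - \<nu>)) *s e"
      have eig: "g *v w = c *s w"
      proof -
        have "s + s / (c - \<nu>) * \<nu> = c * (s / (c - \<nu>))"
          using cl by (simp add: field_simps)
        then show ?thesis
          unfolding w_def
          by (simp add: matrix_vector_right_distrib vec.scale gw l vec.scale_right_distrib
              vec.scale_left_distrib[symmetric] add.assoc)
      qed
      have "h w w = (c * cnj c) * h w w"
        using unitary[of w w] by (simp add: eig form_simps mult.commute)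
      then have ww: "h w w = 0" using nc by (metis mult_cancel_right1)
      have we: "h w e \<noteq> 0" using w0 by (simp add: w_def form_simps e)
      then have "w \<noteq> 0" by auto
      then have iso: "vec.span {w} \<in> isotropic_lines h"
        using ww dim_line[of w] by (auto simp: isotropic_lines_def vec.span_breakdown_eq form_simps)
      have c0: "c \<noteq> 0" using lc by auto
      have "(*v) g ` vec.span {w} = vec.span {w}"
      proof -
        have "(*v) g ` vec.span {w} = vec.span {c *s w}"
          using vec.linear_span_image[OF matrix_vector_mul_linear_gen, of g "{w}"] by (simp add: eig)
        also have "\<dots> = vec.span {w}"
          using vec.span_image_scale[of "{w}" "\<lambda>_. c"] c0 by simp
        finally show ?thesis .
      qed
      then have "act \<gamma> (vec.span {w}) = vec.span {w}"
        by (simp add: g act_proj)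
      then have "vec.span {w} = b"
        using par iso b fixed unfolding parabolic_def by blast
      then have "w \<in> b" using vec.span_base by blast
      then show False
        using we isotropic_line_subset_orth[OF b] orth_span_singleton e(2) by blast
    qed
  qed
  then have "complex_of_real ((cmod c)\<^sup>2) = 1"
    by (metis complex_norm_square)
  then have "(cmod c)\<^sup>2 = 1" using of_real_eq_1_iff by blast
  then have cmod_c: "cmod c = 1"
    by (metis norm_ge_zero power2_eq_1_iff real_sqrt_abs real_sqrt_one abs_of_nonneg)
  have c0: "c \<noteq> 0" using lc by auto
  have "\<nu> = c"
    using lc norm_c by (metis mult_cancel_right mult_zero_right zero_neq_one)
  define k where "k = mat (inverse c) ** g"
  have kx: "k *v x = inverse c *s (g *v x)" for x
    by (simp add: k_def matrix_vector_mul_assoc[symmetric])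
  have "k \<in> carrier UG"
    using UG.m_closed[OF unit_scalar_unitary g(1), of "inverse c"] cmod_c
    by (simp add: k_def norm_inverse)
  moreover have "\<gamma> = proj k"
    using proj_scalar[of "inverse c" g] cmod_c g by (simp add: k_def norm_inverse)
  moreover have "flag_unipotent b k"
    unfolding flag_unipotent_def
  proof (intro conjI ballI allI)
    fix x assume "x \<in> b"
    then obtain a where "x = a *s e" by (auto simp: e(2) vec.span_singleton)
    then show "k *v x = x"
      using l \<open>\<nu> = c\<close> c0 by (simp add: kx vec.scale)
  next
    fix x assume "x \<in> orth h b"
    then obtain s where "g *v x = c *s x + s *s e"
      using on_orth by (auto simp: e(2) orth_span_singleton)
    then have "k *v x - x = (inverse c * s) *s e"
      using c0 by (simp add: kx vec.scale_right_distrib)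
    then show "k *v x - x \<in> b"
      using vec.subspace_scale[OF sub e(4)] by simp
  next
    fix x
    define y where "y = x - (h x e / h w0 e) *s w0"
    have hy: "h y e = 0" using w0 by (simp add: y_def form_simps)
    then obtain s where s: "g *v y = c *s y + s *s e" using on_orth by blast
    have x: "x = y + (h x e / h w0 e) *s w0" by (simp add: y_def)
    have "h (g *v x) e = c * h x e"
      using w0 by (subst (1) x) (simp add: matrix_vector_right_distrib vec.scale s c form_simps te e hy)
    then show "k *v x - x \<in> orth h b"
      using c0 by (simp add: kx e(2) orth_span_singleton form_simps)
  qed
  ultimately show ?thesis by blast
qed

lemma parabolic_pow:
  assumes "b \<in> isotropic_lines h" "parabolic h \<gamma>" "act \<gamma> b = b" "acts_by_translation h b \<gamma>"
    and "\<gamma> [^]\<^bsub>PU h\<^esub> (N::nat) \<noteq> \<one>\<^bsub>PU h\<^esub>"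
  shows "parabolic h (\<gamma> [^]\<^bsub>PU h\<^esub> N)"
proof -
  obtain g where "g \<in> carrier UG" "\<gamma> = proj g" "flag_unipotent b g"
    using parabolic_translation_has_unipotent_lift assms by blast
  then obtain k where "k \<in> carrier UG" "flag_unipotent b k" "\<gamma> [^]\<^bsub>PU h\<^esub> N = proj k"
    using flag_unipotent_pow[OF assms(1)] by metis
  then show ?thesis
    using flag_unipotent_parabolic assms by metis
qed

lemma parabolic_not_one:
  assumes "parabolic h \<gamma>"
  shows "\<gamma> \<noteq> \<one>\<^bsub>PU h\<^esub>"
proof
  assume one: "\<gamma> = \<one>\<^bsub>PU h\<^esub>"
  obtain f where f: "Re (h f f) > 0" using positive_axis by blast
  then have "f \<noteq> 0" by auto
  have "Re (h (a *s f) (a *s f)) > 0" if "a \<noteq> 0" for a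
  proof -
    have "h (a *s f) (a *s f) = complex_of_real ((cmod a)\<^sup>2) * h f f"
      unfolding complex_norm_square by (simp add: form_simps)
    then show ?thesis using f that by simp
  qed
  then have "\<forall>v\<in>vec.span {f}. v \<noteq> 0 \<longrightarrow> Re (h v v) > 0"
    by (auto simp: vec.span_singleton)
  then have "vec.span {f} \<in> complex_ball h"
    using dim_line[OF \<open>f \<noteq> 0\<close>] by (auto simp: complex_ball_def)
  moreover have "act \<gamma> (vec.span {f}) = vec.span {f}"
    by (simp add: one act_one)
  ultimately show False
    using assms by (auto simp: parabolic_def)
qed

lemma parabolic_conj:
  assumes a: "a \<in> carrier (PU h)" and par: "parabolic h \<gamma>"
  shows "parabolic h (a \<otimes>\<^bsub>PU h\<^esub> \<gamma> \<otimes>\<^bsub>PU h\<^esub> inv\<^bsub>PU h\<^esub> a)"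
proof -
  let ?c = "a \<otimes>\<^bsub>PU h\<^esub> \<gamma> \<otimes>\<^bsub>PU h\<^esub> inv\<^bsub>PU h\<^esub> a" and ?i = "inv\<^bsub>PU h\<^esub> a"
  have g: "\<gamma> \<in> carrier (PU h)" using par by (simp add: parabolic_def)
  have i: "?i \<in> carrier (PU h)" using a by simp
  have act_c: "act ?c S = act a (act \<gamma> (act ?i S))" if "vec.subspace S" for S
    using a g that by (simp add: act_mult subspace_act)
  have fixes_iff: "act ?c S = S \<longleftrightarrow> act \<gamma> (act ?i S) = act ?i S" if S: "vec.subspace S" for S
  proof
    assume "act ?c S = S"
    then have "act ?i (act a (act \<gamma> (act ?i S))) = act ?i S"
      by (simp add: act_c[OF S])
    then show "act \<gamma> (act ?i S) = act ?i S"
      using act_inv_cancel(1)[OF a, of "act \<gamma> (act ?i S)"] S g i by (simp add: subspace_act)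
  next
    assume "act \<gamma> (act ?i S) = act ?i S"
    then show "act ?c S = S"
      using act_inv_cancel(2)[OF a S] by (simp add: act_c[OF S])
  qed
  have ball: "act ?c l \<noteq> l" if "l \<in> complex_ball h" for l
    using fixes_iff[of l] act_ball[OF i that] par that by (auto simp: parabolic_def complex_ball_def)
  have ex1: "\<exists>!b. b \<in> isotropic_lines h \<and> act \<gamma> b = b"
    using par by (simp add: parabolic_def)
  obtain b where b: "b \<in> isotropic_lines h" "act \<gamma> b = b"
    using ex1_implies_ex[OF ex1] by auto
  have uniq: "b' = b" if "b' \<in> isotropic_lines h" "act \<gamma> b' = b'" for b'
    using ex1 b that by auto
  have sub: "vec.subspace b'" if "b' \<in> isotropic_lines h" for b'
    using that by (simp add: isotropic_lines_def)
  have "act ?c (act a b) = act a b"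
    using fixes_iff[of "act a b"] b sub by (simp add: act_inv_cancel[OF a] subspace_act[OF a])
  moreover have "b' = act a b" if b': "b' \<in> isotropic_lines h" "act ?c b' = b'" for b'
  proof -
    have "act ?i b' = b"
      using fixes_iff[OF sub[OF b'(1)]] uniq[OF act_isotropic[OF i b'(1)]] b'(2) by blast
    then show ?thesis
      using act_inv_cancel(2)[OF a sub[OF b'(1)]] by blast
  qed
  ultimately have "\<exists>!b. b \<in> isotropic_lines h \<and> act ?c b = b"
    using act_isotropic[OF a b(1)] by blast
  then show ?thesis
    using a g ball by (simp add: parabolic_def)
qed

end


section \<open>Discrete subgroups of a Euclidean space\<close>

locale discrete_additive_subgroup =
  fixes \<Lambda> :: "'a::euclidean_space set"
  assumes zero: "0 \<in> \<Lambda>"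
    and diff: "\<And>x y. x \<in> \<Lambda> \<Longrightarrow> y \<in> \<Lambda> \<Longrightarrow> x - y \<in> \<Lambda>"
    and discrete: "discrete \<Lambda>"
begin

lemma minus: "x \<in> \<Lambda> \<Longrightarrow> - x \<in> \<Lambda>"
  using diff[OF zero] by simp

lemma add: "x \<in> \<Lambda> \<Longrightarrow> y \<in> \<Lambda> \<Longrightarrow> x + y \<in> \<Lambda>"
  using diff[of x "- y"] minus by simp

lemma scale_nat: "x \<in> \<Lambda> \<Longrightarrow> real k *\<^sub>R x \<in> \<Lambda>"
  by (induction k) (auto simp: zero add scaleR_left_distrib)

lemma scale_int: "x \<in> \<Lambda> \<Longrightarrow> of_int k *\<^sub>R x \<in> \<Lambda>"
  using scale_nat[of x "nat k"] minus[OF scale_nat[of x "nat (- k)"]] by (cases "k \<ge> 0") auto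

lemma sum_closed: "finite I \<Longrightarrow> (\<And>i. i \<in> I \<Longrightarrow> f i \<in> \<Lambda>) \<Longrightarrow> sum f I \<in> \<Lambda>"
  by (induction I rule: finite_induct) (auto simp: zero add)

lemma gap_at_zero: "\<exists>d>0. \<forall>x\<in>\<Lambda>. norm x < d \<longrightarrow> x = 0"
proof -
  have "0 isolated_in \<Lambda>"
    using discrete zero by (rule discreteD)
  then show ?thesis
    by (metis isolated_in_dist_Ex_iff dist_0_norm)
qed

lemma finite_bounded:
  assumes "bounded S"
  shows "finite (\<Lambda> \<inter> S)"
proof -
  obtain d where d: "d > 0" "\<And>x. x \<in> \<Lambda> \<Longrightarrow> norm x < d \<Longrightarrow> x = 0"
    using gap_at_zero by blast
  have "x = y" if "x \<in> \<Lambda>" "y \<in> \<Lambda>" "dist x y < d" for x y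
    using d(2)[of "x - y"] diff that by (simp add: dist_norm)
  then have "uniform_discrete \<Lambda>"
    using d(1) by (intro uniformI1) auto
  then show ?thesis
    using assms by (metis bounded_Int inf_le1 uniform_discrete_finite_iff uniform_discrete_subset)
qed

text \<open>Modulo \<open>\<Lambda>\<close>, every \<open>y\<close> with \<open>K y \<in> \<Lambda>\<close> lies in the bounded fundamental parallelotope of
  a real basis of \<open>span \<Lambda>\<close> contained in \<open>\<Lambda>\<close>. Only finitely many such \<open>y\<close> lie in a bounded set.\<close>

lemma finite_torsion_representatives:
  assumes K: "K > (0::nat)"
  shows "\<exists>R. finite R \<and> (\<forall>y. real K *\<^sub>R y \<in> \<Lambda> \<longrightarrow> (\<exists>r\<in>R. y - r \<in> \<Lambda>))"
proof -
  obtain B where B: "B \<subseteq> \<Lambda>" "independent B" "\<Lambda> \<subseteq> span B"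
    using maximal_independent_subset[of \<Lambda>] by blast
  have finB: "finite B" using B(2) independent_imp_finite by blast
  define C where "C = (\<Sum>b\<in>B. norm b)"
  define R where "R = {r. real K *\<^sub>R r \<in> \<Lambda> \<and> norm r \<le> C}"
  have "(\<lambda>r. real K *\<^sub>R r) ` R \<subseteq> \<Lambda> \<inter> cball 0 (real K * C)"
    by (auto simp: R_def mult_left_mono)
  then have "finite ((\<lambda>r. real K *\<^sub>R r) ` R)"
    using finite_bounded[OF bounded_cball] finite_subset by blast
  moreover have "inj_on (\<lambda>r. real K *\<^sub>R r) R"
    using K by (auto intro: inj_onI)
  ultimately have "finite R" by (rule finite_imageD)
  moreover have "\<exists>r\<in>R. y - r \<in> \<Lambda>" if y: "real K *\<^sub>R y \<in> \<Lambda>" for y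
  proof -
    have "(1 / real K) *\<^sub>R (real K *\<^sub>R y) \<in> span B"
      by (rule span_scale) (use y B(3) in blast)
    then have "y \<in> span B" using K by simp
    then obtain u where u: "y = (\<Sum>b\<in>B. u b *\<^sub>R b)"
      using span_finite[OF finB] by auto
    define r where "r = (\<Sum>b\<in>B. frac (u b) *\<^sub>R b)"
    have "y - r = (\<Sum>b\<in>B. u b *\<^sub>R b - frac (u b) *\<^sub>R b)"
      by (simp add: u r_def sum_subtractf)
    also have "\<dots> = (\<Sum>b\<in>B. of_int \<lfloor>u b\<rfloor> *\<^sub>R b)"
      by (simp add: frac_def scaleR_left_diff_distrib)
    finally have yr: "y - r \<in> \<Lambda>"
      using B(1) finB sum_closed[of B "\<lambda>b. of_int \<lfloor>u b\<rfloor> *\<^sub>R b"] scale_int by auto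
    have "real K *\<^sub>R r = real K *\<^sub>R y - real K *\<^sub>R (y - r)"
      by (simp add: algebra_simps)
    then have "real K *\<^sub>R r \<in> \<Lambda>"
      using diff[OF y scale_nat[OF yr]] by metis
    moreover have "norm r \<le> C"
      unfolding r_def C_def
    proof (rule sum_norm_le)
      fix b
      have "frac (u b) * norm b \<le> 1 * norm b"
        using frac_lt_1[of "u b"] by (intro mult_right_mono) auto
      then show "norm (frac (u b) *\<^sub>R b) \<le> norm b"
        using frac_ge_0[of "u b"] by simp
    qed
    ultimately show ?thesis using yr by (auto simp: R_def)
  qed
  ultimately show ?thesis by blast
qed

lemma discrete_if_multiple:
  assumes L: "\<And>x y. x \<in> L \<Longrightarrow> y \<in> L \<Longrightarrow> x - y \<in> L"
    and M: "M > (0::nat)" "\<And>x. x \<in> L \<Longrightarrow> real M *\<^sub>R x \<in> \<Lambda>"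
  shows "discrete L"
proof (rule uniform_discrete_imp_discrete)
  obtain d where d: "d > 0" "\<And>x. x \<in> \<Lambda> \<Longrightarrow> norm x < d \<Longrightarrow> x = 0"
    using gap_at_zero by blast
  have "x = y" if "x \<in> L" "y \<in> L" "dist x y < d / real M" for x y
  proof -
    have "norm (real M *\<^sub>R (x - y)) < d"
      using that(3) M(1) unfolding norm_scaleR dist_norm by (simp add: pos_less_divide_eq mult.commute)
    then have "real M *\<^sub>R (x - y) = 0"
      using d(2) M(2) L that by blast
    then show ?thesis using M(1) by simp
  qed
  then show "uniform_discrete L"
    using d(1) M(1) by (intro uniformI1[of "d / real M"]) auto
qed

end


section \<open>Complex tori with commensurable period groups\<close>

lemma scaleR_eq_scale: "r *\<^sub>R x = complex_of_real r *s (x :: complex^'m)"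
  by (simp add: vec_eq_iff scaleR_conv_of_real[symmetric])

lemma subspace_scaleR: "vec.subspace V \<Longrightarrow> x \<in> V \<Longrightarrow> r *\<^sub>R x \<in> (V :: (complex^'m) set)"
  by (simp add: scaleR_eq_scale vec.subspace_scale)

lemma discrete_additive_subgroup_if_torus:
  "complex_torus (V, \<Lambda>) \<Longrightarrow> discrete_additive_subgroup \<Lambda>"
  by unfold_locales (auto simp: complex_torus_def)

lemma torus_proj_eq: "torus_proj (V, \<Lambda>) v = (\<lambda>x. x + v) ` \<Lambda>"
  by (auto simp: torus_proj_def r_coset_def additive_def)

lemma carrier_torus_group: "carrier (torus_group A) = torus_proj A ` fst A"
  by (auto simp: torus_group_def carrier_FactGroup torus_proj_def additive_def)

lemma torus_proj_eq_iff:
  assumes "complex_torus (V, \<Lambda>)"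
  shows "torus_proj (V, \<Lambda>) u = torus_proj (V, \<Lambda>) v \<longleftrightarrow> u - v \<in> \<Lambda>"
proof
  interpret discrete_additive_subgroup \<Lambda>
    using assms by (rule discrete_additive_subgroup_if_torus)
  {
    assume "torus_proj (V, \<Lambda>) u = torus_proj (V, \<Lambda>) v"
    then have "0 + u \<in> (\<lambda>x. x + v) ` \<Lambda>"
      using zero unfolding torus_proj_eq by blast
    then show "u - v \<in> \<Lambda>" by auto
  next
    assume uv: "u - v \<in> \<Lambda>"
    have "x + u \<in> (\<lambda>x. x + v) ` \<Lambda>" if "x \<in> \<Lambda>" for x
      using add[OF that uv] by (intro image_eqI[of _ _ "x + (u - v)"]) auto
    moreover have "x + v \<in> (\<lambda>x. x + u) ` \<Lambda>" if "x \<in> \<Lambda>" for x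
      using diff[OF that uv] by (intro image_eqI[of _ _ "x - (u - v)"]) auto
    ultimately show "torus_proj (V, \<Lambda>) u = torus_proj (V, \<Lambda>) v"
      unfolding torus_proj_eq by blast
  }
qed

lemma torus_proj_mult:
  assumes "complex_torus (V, \<Lambda>)"
  shows "torus_proj (V, \<Lambda>) u \<otimes>\<^bsub>torus_group (V, \<Lambda>)\<^esub> torus_proj (V, \<Lambda>) v = torus_proj (V, \<Lambda>) (u + v)"
proof -
  interpret discrete_additive_subgroup \<Lambda>
    using assms by (rule discrete_additive_subgroup_if_torus)
  have "{(y + u) + (z + v) | y z. y \<in> \<Lambda> \<and> z \<in> \<Lambda>} = (\<lambda>x. x + (u + v)) ` \<Lambda>" (is "?S = ?T")
  proof
    show "?S \<subseteq> ?T"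
    proof
      fix w assume "w \<in> ?S"
      then obtain y z where yz: "w = (y + u) + (z + v)" "y \<in> \<Lambda>" "z \<in> \<Lambda>" by blast
      show "w \<in> ?T"
        by (rule image_eqI[of _ _ "y + z"]) (simp_all add: yz add)
    qed
    show "?T \<subseteq> ?S"
    proof
      fix w assume "w \<in> ?T"
      then obtain x where x: "w = x + (u + v)" "x \<in> \<Lambda>" by blast
      show "w \<in> ?S"
        by (rule CollectI, rule exI[of _ x], rule exI[of _ 0]) (simp add: x zero)
    qed
  qed
  moreover have "torus_proj (V, \<Lambda>) u \<otimes>\<^bsub>torus_group (V, \<Lambda>)\<^esub> torus_proj (V, \<Lambda>) v
      = {(y + u) + (z + v) | y z. y \<in> \<Lambda> \<and> z \<in> \<Lambda>}"
    by (auto simp: torus_group_def set_mult_def additive_def torus_proj_eq)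
  ultimately show ?thesis
    by (simp add: torus_proj_eq)
qed

text \<open>Multiplication by \<open>N\<close> maps \<open>\<Lambda>\<close> into \<open>\<Lambda>'\<close>, hence descends to \<open>V/\<Lambda> \<rightarrow> V/\<Lambda>'\<close>. Its fibres are
  finite because they are contained in translates of the \<open>M N\<close>-torsion of \<open>V/\<Lambda>\<close>.\<close>

lemma isogeny_precompose_multiplication:
  fixes B :: "'m::finite torus"
  assumes tor: "complex_torus (V, \<Lambda>)" "complex_torus (V, \<Lambda>')"
    and N: "N > 0" "\<And>x. x \<in> \<Lambda> \<Longrightarrow> real N *\<^sub>R x \<in> \<Lambda>'"
    and M: "M > 0" "\<And>x. x \<in> \<Lambda>' \<Longrightarrow> real M *\<^sub>R x \<in> \<Lambda>"
    and iso: "isogeny (V, \<Lambda>') B \<phi>"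
  shows "\<exists>\<psi>. isogeny (V, \<Lambda>) B \<psi>"
proof -
  let ?A = "(V, \<Lambda>)" and ?A' = "(V, \<Lambda>')"
  interpret L: discrete_additive_subgroup \<Lambda>
    using tor(1) by (rule discrete_additive_subgroup_if_torus)
  interpret L': discrete_additive_subgroup \<Lambda>'
    using tor(2) by (rule discrete_additive_subgroup_if_torus)
  have V: "vec.subspace V" using tor(1) by (simp add: complex_torus_def)
  define \<mu> where "\<mu> X = torus_proj ?A' (real N *\<^sub>R (SOME v. v \<in> V \<and> torus_proj ?A v = X))" for X
  have \<mu>: "\<mu> (torus_proj ?A u) = torus_proj ?A' (real N *\<^sub>R u)" if "u \<in> V" for u
  proof -
    define v where "v = (SOME v. v \<in> V \<and> torus_proj ?A v = torus_proj ?A u)"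
    have "v \<in> V \<and> torus_proj ?A v = torus_proj ?A u"
      unfolding v_def by (rule someI[of "\<lambda>v. v \<in> V \<and> torus_proj ?A v = torus_proj ?A u" u]) (simp add: that)
    then have "v - u \<in> \<Lambda>" by (simp add: torus_proj_eq_iff[OF tor(1)])
    then have "real N *\<^sub>R v - real N *\<^sub>R u \<in> \<Lambda>'"
      using N(2) by (metis scaleR_right_diff_distrib)
    then show ?thesis
      by (simp add: \<mu>_def v_def[symmetric] torus_proj_eq_iff[OF tor(2)])
  qed
  have hom: "\<phi> \<in> hom (torus_group ?A') (torus_group B)"
    and hol: "torus_holomorphic ?A' B \<phi>"
    and surj: "\<phi> ` carrier (torus_group ?A') = carrier (torus_group B)"
    and ker: "finite (kernel (torus_group ?A') (torus_group B) \<phi>)"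
    using iso by (auto simp: isogeny_def)
  have scaled: "real N *\<^sub>R u \<in> V" if "u \<in> V" for u
    using V that by (rule subspace_scaleR)
  have \<mu>_image: "\<mu> ` carrier (torus_group ?A) = carrier (torus_group ?A')"
  proof -
    have "(\<lambda>u. real N *\<^sub>R u) ` V = V"
    proof
      show "V \<subseteq> (\<lambda>u. real N *\<^sub>R u) ` V"
      proof
        fix v assume "v \<in> V"
        then have "v = real N *\<^sub>R ((1 / real N) *\<^sub>R v)" "(1 / real N) *\<^sub>R v \<in> V"
          using N(1) subspace_scaleR[OF V] by auto
        then show "v \<in> (\<lambda>u. real N *\<^sub>R u) ` V" by (rule image_eqI)
      qed
    qed (use scaled in blast)
    then have "(\<lambda>u. torus_proj ?A' (real N *\<^sub>R u)) ` V = torus_proj ?A' ` V"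
      by (metis image_image)
    then show ?thesis
      by (simp add: carrier_torus_group image_image \<mu>)
  qed
  have "(\<lambda>X. \<phi> (\<mu> X)) \<in> hom (torus_group ?A) (torus_group B)"
  proof (rule homI)
    fix X assume "X \<in> carrier (torus_group ?A)"
    then show "\<phi> (\<mu> X) \<in> carrier (torus_group B)"
      using \<mu>_image hom by (auto simp: hom_def)
  next
    fix X Y assume X: "X \<in> carrier (torus_group ?A)" and Y: "Y \<in> carrier (torus_group ?A)"
    then obtain u v where uv: "u \<in> V" "X = torus_proj ?A u" "v \<in> V" "Y = torus_proj ?A v"
      by (auto simp: carrier_torus_group)
    have "\<mu> (X \<otimes>\<^bsub>torus_group ?A\<^esub> Y) = \<mu> X \<otimes>\<^bsub>torus_group ?A'\<^esub> \<mu> Y"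
      using uv V by (simp add: torus_proj_mult tor \<mu> vec.subspace_add scaleR_right_distrib)
    then show "\<phi> (\<mu> (X \<otimes>\<^bsub>torus_group ?A\<^esub> Y)) = \<phi> (\<mu> X) \<otimes>\<^bsub>torus_group B\<^esub> \<phi> (\<mu> Y)"
      using hom_mult[OF hom, of "\<mu> X" "\<mu> Y"] X Y \<mu>_image by auto
  qed
  moreover have "torus_holomorphic ?A B (\<lambda>X. \<phi> (\<mu> X))"
    unfolding torus_holomorphic_def
  proof
    fix v assume "v \<in> fst ?A"
    then have "real N *\<^sub>R v \<in> fst ?A'" using scaled by simp
    then obtain U F where U: "open U" "real N *\<^sub>R v \<in> U"
      and F: "\<And>u. u \<in> U \<inter> V \<Longrightarrow> F u \<in> fst B \<and> \<phi> (torus_proj ?A' u) = torus_proj B (F u) \<and>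
           (\<exists>D :: complex^'m^'m. (F has_derivative (\<lambda>w. D *v w)) (at u within V))"
      using hol unfolding torus_holomorphic_def by fastforce
    let ?U = "(\<lambda>u. real N *\<^sub>R u) -` U" and ?F = "\<lambda>u. F (real N *\<^sub>R u)"
    have "open ?U"
      using U(1) by (intro open_vimage continuous_intros)
    moreover have "?F u \<in> fst B \<and> \<phi> (\<mu> (torus_proj ?A u)) = torus_proj B (?F u) \<and>
        (\<exists>D :: complex^'m^'m. (?F has_derivative (\<lambda>w. D *v w)) (at u within V))"
      if u: "u \<in> ?U \<inter> V" for u
    proof -
      have Nu: "real N *\<^sub>R u \<in> U \<inter> V" using u scaled by auto
      obtain D :: "complex^'m^'m"
        where "(F has_derivative (\<lambda>w. D *v w)) (at (real N *\<^sub>R u) within V)"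
        using F[OF Nu] by blast
      then have D: "(F has_derivative (\<lambda>w. D *v w)) (at (real N *\<^sub>R u) within (\<lambda>u. real N *\<^sub>R u) ` V)"
        using scaled by (elim has_derivative_subset) blast
      have scale: "((\<lambda>u. real N *\<^sub>R u) has_derivative (\<lambda>w. real N *\<^sub>R w)) (at u within V)"
        by (auto intro!: derivative_eq_intros)
      have "(?F has_derivative (\<lambda>w. D *v (real N *\<^sub>R w))) (at u within V)"
        by (rule has_derivative_in_compose[OF scale D])
      moreover have "D *v (real N *\<^sub>R w) = (D ** mat (of_nat N)) *v w" for w
        by (simp add: matrix_vector_mul_assoc[symmetric] scaleR_eq_scale)
      ultimately show ?thesis
        using F[OF Nu] u by (auto simp: \<mu>)
    qed
    ultimately show "\<exists>U F. open U \<and> v \<in> U \<and> (\<forall>u\<in>U \<inter> fst ?A. F u \<in> fst B \<and>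
        \<phi> (\<mu> (torus_proj ?A u)) = torus_proj B (F u) \<and>
        (\<exists>D :: complex^'m^'m. (F has_derivative (\<lambda>w. D *v w)) (at u within fst ?A)))"
      using U(2) by (intro exI[of _ ?U] exI[of _ ?F]) auto
  qed
  moreover have "(\<lambda>X. \<phi> (\<mu> X)) ` carrier (torus_group ?A) = carrier (torus_group B)"
    using surj \<mu>_image by (metis image_image)
  moreover have "finite (kernel (torus_group ?A) (torus_group B) (\<lambda>X. \<phi> (\<mu> X)))"
  proof -
    have fibre: "finite (\<mu> -` {Y} \<inter> carrier (torus_group ?A))" for Y
    proof (cases "\<mu> -` {Y} \<inter> carrier (torus_group ?A) = {}")
      case False
      then obtain u0 where u0: "u0 \<in> V" "\<mu> (torus_proj ?A u0) = Y"
        by (auto simp: carrier_torus_group)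
      obtain R where R: "finite R" "\<And>y. real (M * N) *\<^sub>R y \<in> \<Lambda> \<Longrightarrow> \<exists>r\<in>R. y - r \<in> \<Lambda>"
        using L.finite_torsion_representatives[of "M * N"] M(1) N(1) by auto
      have "\<mu> -` {Y} \<inter> carrier (torus_group ?A) \<subseteq> (\<lambda>r. torus_proj ?A (u0 + r)) ` R"
      proof
        fix X assume "X \<in> \<mu> -` {Y} \<inter> carrier (torus_group ?A)"
        then obtain u where u: "u \<in> V" "X = torus_proj ?A u" "\<mu> X = Y"
          by (auto simp: carrier_torus_group)
        then have "torus_proj ?A' (real N *\<^sub>R u) = torus_proj ?A' (real N *\<^sub>R u0)"
          using u0 \<mu> by metis
        then have "real N *\<^sub>R u - real N *\<^sub>R u0 \<in> \<Lambda>'"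
          by (simp add: torus_proj_eq_iff[OF tor(2)])
        then have "real M *\<^sub>R (real N *\<^sub>R (u - u0)) \<in> \<Lambda>"
          using M(2) by (metis scaleR_right_diff_distrib)
        then obtain r where r: "r \<in> R" "(u - u0) - r \<in> \<Lambda>"
          using R(2)[of "u - u0"] by auto
        then have "X = torus_proj ?A (u0 + r)"
          by (simp add: u torus_proj_eq_iff[OF tor(1)] diff_diff_eq)
        then show "X \<in> (\<lambda>r. torus_proj ?A (u0 + r)) ` R" using r(1) by blast
      qed
      then show ?thesis using R(1) by (meson finite_imageI finite_subset)
    qed simp
    have "kernel (torus_group ?A) (torus_group B) (\<lambda>X. \<phi> (\<mu> X))
        \<subseteq> \<mu> -` kernel (torus_group ?A') (torus_group B) \<phi> \<inter> carrier (torus_group ?A)"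
      using \<mu>_image by (auto simp: kernel_def)
    moreover have "finite (\<mu> -` kernel (torus_group ?A') (torus_group B) \<phi> \<inter> carrier (torus_group ?A))"
      by (rule finite_finite_vimage_IntI[OF ker fibre])
    ultimately show ?thesis by (rule finite_subset)
  qed
  ultimately show ?thesis
    unfolding isogeny_def by blast
qed

lemma isogeny_class_eq_if_commensurable:
  assumes "complex_torus (V, \<Lambda>)" "complex_torus (V, \<Lambda>')"
    and "N > 0" "\<And>x. x \<in> \<Lambda> \<Longrightarrow> real N *\<^sub>R x \<in> \<Lambda>'"
    and "M > 0" "\<And>x. x \<in> \<Lambda>' \<Longrightarrow> real M *\<^sub>R x \<in> \<Lambda>"
  shows "isogeny_class (V, \<Lambda>) = isogeny_class (V, \<Lambda>')"
proof -
  have "(\<exists>\<phi>. isogeny (V, \<Lambda>) B \<phi>) \<longleftrightarrow> (\<exists>\<phi>. isogeny (V, \<Lambda>') B \<phi>)" for B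
    using isogeny_precompose_multiplication[OF assms, of B]
      isogeny_precompose_multiplication[OF assms(2,1,5,6,3,4), of B] by blast
  then show ?thesis
    by (simp add: isogeny_class_def)
qed

text \<open>A Riemann form for \<open>\<Lambda>\<close>, pulled back along multiplication by \<open>M\<close>, is a Riemann form
  for \<open>\<Lambda>'\<close>.\<close>

lemma abelian_variety_if_commensurable:
  assumes A: "abelian_variety (V, \<Lambda>)"
    and L': "\<Lambda>' \<subseteq> V" "0 \<in> \<Lambda>'" "\<And>x y. x \<in> \<Lambda>' \<Longrightarrow> y \<in> \<Lambda>' \<Longrightarrow> x - y \<in> \<Lambda>'"
    and N: "N > 0" "\<And>x. x \<in> \<Lambda> \<Longrightarrow> real N *\<^sub>R x \<in> \<Lambda>'"
    and M: "M > 0" "\<And>x. x \<in> \<Lambda>' \<Longrightarrow> real M *\<^sub>R x \<in> \<Lambda>"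
  shows "abelian_variety (V, \<Lambda>')"
proof -
  have tor: "complex_torus (V, \<Lambda>)" using A by (simp add: abelian_variety_def)
  obtain H where H: "riemann_form (V, \<Lambda>) H" using A by (auto simp: abelian_variety_def)
  interpret L: discrete_additive_subgroup \<Lambda>
    using tor by (rule discrete_additive_subgroup_if_torus)
  have V: "vec.subspace V" and span: "span \<Lambda> = V"
    using tor by (simp_all add: complex_torus_def)
  have scaled: "real M *\<^sub>R u \<in> V" if "u \<in> V" for u
    using V that by (rule subspace_scaleR)
  have "discrete \<Lambda>'"
    using L'(3) M by (rule L.discrete_if_multiple)
  moreover have "span \<Lambda>' = V"
  proof
    have "subspace V" using span subspace_span by metis
    then show "span \<Lambda>' \<subseteq> V" using L'(1) by (rule span_minimal[rotated])
    have "x \<in> span \<Lambda>'" if "x \<in> \<Lambda>" for x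
    proof -
      have "(1 / real N) *\<^sub>R (real N *\<^sub>R x) \<in> span \<Lambda>'"
        using N(2)[OF that] by (rule span_scale[OF span_base])
      then show ?thesis using N(1) by simp
    qed
    then show "V \<subseteq> span \<Lambda>'"
      unfolding span[symmetric] by (intro span_minimal subspace_span) blast
  qed
  ultimately have "complex_torus (V, \<Lambda>')"
    using V L' by (simp add: complex_torus_def)
  moreover have "riemann_form (V, \<Lambda>') (\<lambda>x y. H (real M *\<^sub>R x) (real M *\<^sub>R y))"
  proof -
    have comm: "real M *\<^sub>R (c *s x) = c *s (real M *\<^sub>R x)" for c and x :: "complex^'a"
      by (simp add: scaleR_eq_scale mult.commute)
    have nonzero: "real M *\<^sub>R x \<noteq> 0" if "x \<noteq> 0" for x :: "complex^'a"
      using M(1) that by simp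
    have H_add: "\<forall>x\<in>V. \<forall>y\<in>V. \<forall>z\<in>V. H (x + y) z = H x z + H y z"
      and H_scale: "\<forall>c. \<forall>x\<in>V. \<forall>y\<in>V. H (c *s x) y = c * H x y"
      and H_cnj: "\<forall>x\<in>V. \<forall>y\<in>V. H y x = cnj (H x y)"
      and H_pos: "\<forall>x\<in>V. x \<noteq> 0 \<longrightarrow> Re (H x x) > 0"
      and H_int: "\<forall>x\<in>\<Lambda>. \<forall>y\<in>\<Lambda>. Im (H x y) \<in> \<int>"
      using H unfolding riemann_form_def prod.case by blast+
    show ?thesis
      unfolding riemann_form_def prod.case
    proof (intro conjI ballI allI impI)
      fix x y z assume "x \<in> V" "y \<in> V" "z \<in> V"
      then show "H (real M *\<^sub>R (x + y)) (real M *\<^sub>R z)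
          = H (real M *\<^sub>R x) (real M *\<^sub>R z) + H (real M *\<^sub>R y) (real M *\<^sub>R z)"
        using H_add scaled by (simp add: scaleR_right_distrib)
    next
      fix c x y assume "x \<in> V" "y \<in> V"
      then show "H (real M *\<^sub>R (c *s x)) (real M *\<^sub>R y) = c * H (real M *\<^sub>R x) (real M *\<^sub>R y)"
        using H_scale scaled by (simp add: comm)
    next
      fix x y assume "x \<in> V" "y \<in> V"
      then show "H (real M *\<^sub>R y) (real M *\<^sub>R x) = cnj (H (real M *\<^sub>R x) (real M *\<^sub>R y))"
        using scaled by (intro H_cnj[rule_format])
    next
      fix x assume "x \<in> V" "x \<noteq> 0"
      then show "Re (H (real M *\<^sub>R x) (real M *\<^sub>R x)) > 0"
        using H_pos scaled nonzero by blast
    next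
      fix x y assume "x \<in> \<Lambda>'" "y \<in> \<Lambda>'"
      then show "Im (H (real M *\<^sub>R x) (real M *\<^sub>R y)) \<in> \<int>"
        using H_int M(2) by blast
    qed
  qed
  ultimately show ?thesis
    by (auto simp: abelian_variety_def)
qed


section \<open>Commensurability up to powers\<close>

lemma (in group) subgroup_nat_pow_closed:
  assumes "subgroup K G" "x \<in> K"
  shows "x [^] (n::nat) \<in> K"
  using assms by (induction n) (auto simp: subgroup.one_closed subgroup.m_closed)

text \<open>Among the first \<open>i + 1\<close> powers of \<open>x\<close>, where \<open>i\<close> is the index, two lie in the same coset of
  \<open>K\<close>, so \<open>x [^] d \<in> K\<close> for some \<open>0 < d \<le> i\<close>. The factorial of \<open>i\<close> is an exponent that works for
  all \<open>x\<close>.\<close>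

lemma (in group) finite_index_uniform_power:
  assumes K: "subgroup K G" and fin: "finite (rcosets K)"
  shows "\<exists>N>0. \<forall>x\<in>carrier G. x [^] (N::nat) \<in> K"
proof (intro exI[of _ "fact (card (rcosets K))"] conjI ballI)
  let ?i = "card (rcosets K)"
  fix x assume x: "x \<in> carrier G"
  let ?f = "\<lambda>j::nat. K #> (x [^] j)"
  have sub: "K \<subseteq> carrier G" using K by (rule subgroup.subset)
  have "?f ` {..?i} \<subseteq> rcosets K"
    using x sub by (auto intro: rcosetsI)
  then have "card (?f ` {..?i}) \<le> ?i"
    using fin by (rule card_mono[rotated])
  then have "\<not> inj_on ?f {..?i}"
    by (auto dest: card_image)
  then obtain j k where jk: "j < k" "k \<le> ?i" "?f j = ?f k"
    unfolding inj_on_def by (metis atMost_iff nat_neq_iff)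
  have "x [^] k \<in> K #> (x [^] j)"
    unfolding jk(3) using x K by (intro rcos_self) auto
  then obtain y where y: "y \<in> K" "x [^] k = y \<otimes> x [^] j"
    by (auto simp: r_coset_def)
  have "x [^] (k - j) \<otimes> x [^] j = x [^] k"
    using x jk(1) by (simp add: nat_pow_mult)
  then have "x [^] (k - j) = y"
    using x y sub by (metis nat_pow_closed right_cancel subsetD)
  then have pow: "x [^] (k - j) \<in> K" using y by simp
  have "(k - j) dvd fact ?i"
    using jk by (intro dvd_fact) auto
  then obtain q where "(fact ?i :: nat) = (k - j) * q" ..
  then show "x [^] (fact ?i :: nat) \<in> K"
    using subgroup_nat_pow_closed[OF K pow, of q] x by (simp add: nat_pow_pow)
qed simp

lemma (in group) finite_index_subgroup_power:
  assumes "subgroup H G" "finite_index_subgroup G H K"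
  shows "K \<subseteq> H" "\<exists>N>0. \<forall>x\<in>H. x [^] (N::nat) \<in> K"
proof -
  interpret H: group "G\<lparr>carrier := H\<rparr>"
    using assms(1) by (rule subgroup_imp_group)
  have K: "subgroup K (G\<lparr>carrier := H\<rparr>)" "finite (rcosets\<^bsub>G\<lparr>carrier := H\<rparr>\<^esub> K)"
    using assms(2) by (auto simp: finite_index_subgroup_def)
  then show "K \<subseteq> H" using subgroup.subset by fastforce
  show "\<exists>N>0. \<forall>x\<in>H. x [^] (N::nat) \<in> K"
    using H.finite_index_uniform_power[OF K] by (simp add: nat_pow_consistent[symmetric])
qed

lemma (in group) conj_nat_pow:
  assumes "a \<in> carrier G" "x \<in> carrier G"
  shows "(a \<otimes> x \<otimes> inv a) [^] (n::nat) = a \<otimes> x [^] n \<otimes> inv a"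
proof (induction n)
  case 0
  then show ?case using assms by simp
next
  case (Suc n)
  have "a \<otimes> x [^] n \<otimes> inv a \<otimes> (a \<otimes> x \<otimes> inv a) = a \<otimes> x [^] n \<otimes> (inv a \<otimes> a) \<otimes> (x \<otimes> inv a)"
    using assms by (simp only: m_assoc m_closed inv_closed nat_pow_closed)
  then show ?case
    using Suc assms by (simp add: m_assoc)
qed

lemma (in group) conj_inv_cancel:
  assumes "a \<in> carrier G" "x \<in> carrier G"
  shows "inv a \<otimes> (a \<otimes> x \<otimes> inv a) \<otimes> a = x"
proof -
  have "inv a \<otimes> (a \<otimes> x \<otimes> inv a) \<otimes> a = (inv a \<otimes> a) \<otimes> x \<otimes> (inv a \<otimes> a)"
    using assms by (simp only: m_assoc m_closed inv_closed)
  then show ?thesis using assms by simp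
qed

lemma (in group) subgroup_conj:
  assumes H: "subgroup H G" and a: "a \<in> carrier G"
  shows "subgroup ((\<lambda>x. a \<otimes> x \<otimes> inv a) ` H) G"
proof -
  have sub: "x \<in> carrier G" if "x \<in> H" for x
    using that H by (rule subgroup.mem_carrier[rotated])
  have "(\<lambda>x. a \<otimes> x \<otimes> inv a) \<in> hom G G"
  proof (rule homI)
    fix x y assume "x \<in> carrier G" "y \<in> carrier G"
    then have "a \<otimes> x \<otimes> inv a \<otimes> (a \<otimes> y \<otimes> inv a) = a \<otimes> x \<otimes> (inv a \<otimes> a) \<otimes> (y \<otimes> inv a)"
      using a by (simp only: m_assoc m_closed inv_closed)
    then show "a \<otimes> (x \<otimes> y) \<otimes> inv a = a \<otimes> x \<otimes> inv a \<otimes> (a \<otimes> y \<otimes> inv a)"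
      using a \<open>x \<in> carrier G\<close> \<open>y \<in> carrier G\<close> by (simp add: m_assoc)
  qed (use a in simp)
  then show ?thesis
    using group_hom.subgroup_img_is_subgroup[of G G, OF _ H] is_group
    by (simp add: group_hom_def group_hom_axioms_def)
qed

text \<open>A power of \<open>x \<in> L1\<close> lies in the common subgroup \<open>K\<close>, hence in the conjugate of \<open>H2\<close>, and a
  further power lies in the conjugate of \<open>L2\<close>. In the other direction, a power of a conjugate of
  \<open>x \<in> L2\<close> lies in \<open>K\<close>, hence in \<open>H1\<close>, and a further power lies in \<open>L1\<close>.\<close>

lemma (in group) commensurable_uniform_powers:
  assumes H: "subgroup H1 G" "subgroup H2 G"
    and comm: "commensurable G H1 H2"
    and fin: "finite_index_subgroup G H1 L1" "finite_index_subgroup G H2 L2"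
  obtains a N M where "a \<in> carrier G"
    and "N > (0::nat)" "\<And>x. x \<in> L1 \<Longrightarrow> a \<otimes> x [^] N \<otimes> inv a \<in> L2"
    and "M > (0::nat)" "\<And>x. x \<in> L2 \<Longrightarrow> inv a \<otimes> x [^] M \<otimes> a \<in> L1"
proof -
  obtain g K where g: "g \<in> carrier G" and K: "finite_index_subgroup G H1 K"
      "finite_index_subgroup G ((\<lambda>x. g \<otimes> x \<otimes> inv g) ` H2) K"
    using comm unfolding commensurable_def by blast
  let ?C = "(\<lambda>x. g \<otimes> x \<otimes> inv g) ` H2"
  note C = subgroup_conj[OF H(2) g]
  have carr: "x \<in> carrier G" if "x \<in> H1 \<or> x \<in> H2" for x
    using that H subgroup.mem_carrier by metis
  obtain p1 where p1: "p1 > 0" "\<And>x. x \<in> H1 \<Longrightarrow> x [^] (p1::nat) \<in> K"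
    using finite_index_subgroup_power(2)[OF H(1) K(1)] by blast
  obtain p2 where p2: "p2 > 0" "\<And>x. x \<in> ?C \<Longrightarrow> x [^] (p2::nat) \<in> K"
    using finite_index_subgroup_power(2)[OF C K(2)] by blast
  obtain n1 where n1: "n1 > 0" "\<And>x. x \<in> H1 \<Longrightarrow> x [^] (n1::nat) \<in> L1"
    using finite_index_subgroup_power(2)[OF H(1) fin(1)] by blast
  obtain n2 where n2: "n2 > 0" "\<And>x. x \<in> H2 \<Longrightarrow> x [^] (n2::nat) \<in> L2"
    using finite_index_subgroup_power(2)[OF H(2) fin(2)] by blast
  have KC: "K \<subseteq> ?C" "K \<subseteq> H1" and L: "L1 \<subseteq> H1" "L2 \<subseteq> H2"
    using finite_index_subgroup_power(1) H C K fin by blast+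
  show ?thesis
  proof (rule that[of "inv g" "p1 * n2" "p2 * n1"])
    fix x assume "x \<in> L1"
    then have x: "x \<in> H1" using L by blast
    then have "x [^] p1 \<in> ?C" using p1 KC by blast
    then obtain y where y: "y \<in> H2" "x [^] p1 = g \<otimes> y \<otimes> inv g" by blast
    then have "inv g \<otimes> x [^] p1 \<otimes> g = y"
      using conj_inv_cancel[OF g] carr by simp
    then have "(inv g \<otimes> x [^] p1 \<otimes> inv (inv g)) [^] n2 \<in> L2"
      using y n2 g by simp
    then show "inv g \<otimes> x [^] (p1 * n2) \<otimes> inv (inv g) \<in> L2"
      using conj_nat_pow[of "inv g" "x [^] p1" n2] g carr x by (simp add: nat_pow_pow)
  next
    fix x assume "x \<in> L2"
    then have x: "x \<in> H2" using L by blast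
    then have "(g \<otimes> x \<otimes> inv g) [^] p2 \<in> H1" using p2 KC by blast
    then have "((g \<otimes> x \<otimes> inv g) [^] p2) [^] n1 \<in> L1" by (rule n1(2))
    moreover have "((g \<otimes> x \<otimes> inv g) [^] p2) [^] n1 = g \<otimes> x [^] (p2 * n1) \<otimes> inv g"
      using g carr x by (simp add: nat_pow_pow conj_nat_pow)
    ultimately show "inv (inv g) \<otimes> x [^] (p2 * n1) \<otimes> inv g \<in> L1"
      using g by simp
  qed (use g p1 p2 n1 n2 in auto)
qed


section \<open>Transport of cusps and of their translation lattices\<close>

context lorentzian_form
begin

lemma subspace_cusp_space: "P \<in> cusp_space h b \<Longrightarrow> vec.subspace P"
  by (simp add: cusp_space_def)

lemma act_cusp_space:
  assumes a: "a \<in> carrier (PU h)" and b: "vec.subspace b" and P: "P \<in> cusp_space h b"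
  shows "act a P \<in> cusp_space h (act a b)"
proof -
  obtain g where g: "g \<in> carrier UG" "a = proj g"
    using a by (auto simp: carrier_PU)
  have sub: "vec.subspace P" using P by (rule subspace_cusp_space)
  obtain w where w: "w \<in> P" "w \<notin> orth h b"
    using P by (auto simp: cusp_space_def)
  then have "g *v w \<in> act a P" "g *v w \<notin> orth h (act a b)"
    using g sub orth_act[OF g(1) b] by (auto simp: act_proj)
  then show ?thesis
    using P subspace_act[OF a sub] dim_act[OF a sub] by (auto simp: cusp_space_def act_def)
qed

lemma affine_iso_act:
  assumes a: "a \<in> carrier (PU h)" and b: "vec.subspace b" and iso: "affine_iso h b V \<alpha>"
  shows "affine_iso h (act a b) V (\<lambda>v. act a (\<alpha> v))"
proof -
  obtain g where g: "g \<in> carrier UG" "a = proj g"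
    using a by (auto simp: carrier_PU)
  obtain w0 and L :: "complex^'m^'m" where w0: "w0 \<notin> orth h b" and L: "\<forall>v\<in>V. L *v v \<in> orth h b"
    and \<alpha>: "\<forall>v\<in>V. \<alpha> v = vec.span (insert (w0 + L *v v) b)"
    using iso unfolding affine_iso_def by auto
  have bij: "bij_betw \<alpha> V (cusp_space h b)"
    using iso by (simp add: affine_iso_def)
  have inv_a: "inv\<^bsub>PU h\<^esub> a \<in> carrier (PU h)" using a by simp
  have bij_act: "bij_betw (act a) (cusp_space h b) (cusp_space h (act a b))"
  proof (rule bij_betw_byWitness[of _ "act (inv\<^bsub>PU h\<^esub> a)"])
    show "\<forall>P\<in>cusp_space h b. act (inv\<^bsub>PU h\<^esub> a) (act a P) = P"
      "\<forall>P\<in>cusp_space h (act a b). act a (act (inv\<^bsub>PU h\<^esub> a) P) = P"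
      using act_inv_cancel[OF a] subspace_cusp_space by auto
    show "act a ` cusp_space h b \<subseteq> cusp_space h (act a b)"
      using act_cusp_space[OF a b] by blast
    show "act (inv\<^bsub>PU h\<^esub> a) ` cusp_space h (act a b) \<subseteq> cusp_space h b"
      using act_cusp_space[OF inv_a subspace_act[OF a b]] act_inv_cancel(1)[OF a b] by auto
  qed
  have "bij_betw (\<lambda>v. act a (\<alpha> v)) V (cusp_space h (act a b))"
    using bij_betw_trans[OF bij bij_act] by (simp add: comp_def)
  moreover have "g *v w0 \<notin> orth h (act a b)"
    using w0 g b by (simp add: orth_act)
  moreover have "(g ** L) *v v \<in> orth h (act a b)" if "v \<in> V" for v
    using L that g b by (simp add: orth_act matrix_vector_mul_assoc[symmetric])
  moreover have "act a (\<alpha> v) = vec.span (insert (g *v w0 + (g ** L) *v v) (act a b))" if "v \<in> V" for v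
    using \<alpha> that g b
    by (simp add: act_proj vec.linear_span_image[OF matrix_vector_mul_linear_gen, symmetric]
        matrix_vector_right_distrib matrix_vector_mul_assoc)
  ultimately show ?thesis
    unfolding affine_iso_def by blast
qed

text \<open>Write \<open>\<alpha> u\<close> as the plane spanned by \<open>b\<close> and \<open>w0 + L u\<close>. Since \<open>t\<close> vanishes on \<open>b\<^sup>\<bottom>\<close>, it moves
  each \<open>w0 + L u\<close> by the same vector \<open>t w0 \<in> b\<^sup>\<bottom>\<close>. Surjectivity of the chart provides the
  \<open>v \<in> V\<close> with \<open>L v = t w0\<close> modulo \<open>b\<close>.\<close>

lemma translation_in_chart:
  assumes b: "b \<in> isotropic_lines h" and iso: "affine_iso h b V \<alpha>" and V: "vec.subspace V"
    and \<gamma>: "\<gamma> \<in> carrier (PU h)" "act \<gamma> b = b" "acts_by_translation h b \<gamma>"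
  shows "\<exists>v\<in>V. \<forall>u\<in>V. act \<gamma> (\<alpha> u) = \<alpha> (u + v)"
proof -
  have sub: "vec.subspace b" using b by (simp add: isotropic_lines_def)
  obtain e where e: "e \<noteq> 0" "b = vec.span {e}" "h e e = 0" "e \<in> b"
    by (rule isotropic_line_generator[OF b])
  obtain w0 and L :: "complex^'m^'m" where w0: "w0 \<notin> orth h b" and L: "\<forall>v\<in>V. L *v v \<in> orth h b"
    and \<alpha>: "\<forall>v\<in>V. \<alpha> v = vec.span (insert (w0 + L *v v) b)"
    using iso unfolding affine_iso_def by auto
  have bij: "bij_betw \<alpha> V (cusp_space h b)"
    using iso by (simp add: affine_iso_def)
  obtain t :: "complex^'m^'m" where "(\<forall>w. t *v w \<in> orth h b) \<and> (\<forall>w\<in>orth h b. t *v w = 0) \<and>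
      (\<forall>P\<in>cusp_space h b. act \<gamma> P = (\<lambda>w. w + t *v w) ` P)"
    using \<gamma>(3) unfolding acts_by_translation_def by meson
  then have t: "\<And>w. t *v w \<in> orth h b" "\<And>w. w \<in> orth h b \<Longrightarrow> t *v w = 0"
    and act_t: "\<And>P. P \<in> cusp_space h b \<Longrightarrow> act \<gamma> P = (\<lambda>w. w + t *v w) ` P"
    by simp_all
  have moved: "act \<gamma> (\<alpha> u) = vec.span (insert (w0 + L *v u + t *v w0) b)" if u: "u \<in> V" for u
  proof -
    have tb: "t *v x = 0" if "x \<in> b" for x
      using t(2) isotropic_line_subset_orth[OF b] that by blast
    have "\<alpha> u \<in> cusp_space h b"
      using bij u by (auto simp: bij_betw_def)
    then have "act \<gamma> (\<alpha> u) = (\<lambda>w. (mat 1 + t) *v w) ` vec.span (insert (w0 + L *v u) b)"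
      using \<alpha> u by (simp add: act_t matrix_vector_mult_add_rdistrib)
    also have "\<dots> = vec.span ((\<lambda>w. (mat 1 + t) *v w) ` insert (w0 + L *v u) b)"
      by (rule vec.linear_span_image[OF matrix_vector_mul_linear_gen, symmetric])
    also have "(\<lambda>w. (mat 1 + t) *v w) ` b = (\<lambda>w. w) ` b"
      by (intro image_cong) (simp_all add: matrix_vector_mult_add_rdistrib tb)
    then have "(\<lambda>w. (mat 1 + t) *v w) ` insert (w0 + L *v u) b = insert (w0 + L *v u + t *v w0) b"
      using t(2) L u by (simp add: matrix_vector_mult_add_rdistrib matrix_vector_right_distrib)
    finally show ?thesis .
  qed
  have V0: "0 \<in> V" using V by (rule vec.subspace_0)
  have "act \<gamma> (\<alpha> 0) \<in> cusp_space h b"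
    using act_cusp_space[OF \<gamma>(1) sub, of "\<alpha> 0"] \<gamma>(2) bij V0 by (auto simp: bij_betw_def)
  then obtain v where v: "v \<in> V" "act \<gamma> (\<alpha> 0) = \<alpha> v"
    using bij by (auto simp: bij_betw_def)
  have "w0 + t *v w0 \<in> vec.span (insert (w0 + L *v v) b)"
    using moved[OF V0] v \<alpha> vec.span_base[of "w0 + t *v w0" "insert (w0 + t *v w0) b"] by simp
  then obtain c where c: "w0 + t *v w0 - c *s (w0 + L *v v) \<in> vec.span b"
    unfolding vec.span_insert by blast
  moreover have "vec.span b = b"
    using sub vec.span_eq_iff by blast
  ultimately have inb: "w0 + t *v w0 - c *s (w0 + L *v v) \<in> b" by simp
  have tL: "h (t *v w0) e = 0" "h (L *v v) e = 0"
    using t(1) L v by (auto simp: e(2) orth_span_singleton)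
  have "h (w0 + t *v w0 - c *s (w0 + L *v v)) e = 0"
    using inb isotropic_line_subset_orth[OF b] by (auto simp: e(2) orth_span_singleton)
  then have "(1 - c) * h w0 e = 0"
    by (simp add: form_simps tL algebra_simps)
  then have "c = 1"
    using w0 by (simp add: e(2) orth_span_singleton)
  then have tLb: "t *v w0 - L *v v \<in> b" using inb by simp
  have "act \<gamma> (\<alpha> u) = \<alpha> (u + v)" if u: "u \<in> V" for u
  proof -
    have uv: "u + v \<in> V" using V u v by (simp add: vec.subspace_add)
    let ?x = "w0 + L *v u + t *v w0" and ?y = "w0 + L *v (u + v)"
    have xy: "?x - ?y = t *v w0 - L *v v" by (simp add: matrix_vector_right_distrib)
    have swap: "vec.span (insert x b) \<subseteq> vec.span (insert y b)" if "x - y \<in> b" for x y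
    proof (rule vec.span_minimal)
      have "y + (x - y) \<in> vec.span (insert y b)"
        using that by (intro vec.span_add vec.span_base) auto
      then show "insert x b \<subseteq> vec.span (insert y b)"
        by (auto intro: vec.span_base)
    qed simp
    have "?y - ?x \<in> b"
      using vec.subspace_neg[OF sub tLb] xy by (metis minus_diff_eq)
    then have "vec.span (insert ?x b) = vec.span (insert ?y b)"
      using swap[of ?x ?y] swap[of ?y ?x] tLb xy by auto
    then show ?thesis
      using moved[OF u] \<alpha> uv by simp
  qed
  then show ?thesis using v(1) by blast
qed

lemma act_pow_translation:
  assumes "\<gamma> \<in> carrier (PU h)" and sub: "\<And>u. u \<in> V \<Longrightarrow> vec.subspace (\<alpha> u)"
    and V: "vec.subspace V" "v \<in> V" and tr: "\<forall>u\<in>V. act \<gamma> (\<alpha> u) = \<alpha> (u + v)" and u: "u \<in> V"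
  shows "act (\<gamma> [^]\<^bsub>PU h\<^esub> (N::nat)) (\<alpha> u) = \<alpha> (u + real N *\<^sub>R v)"
  using u
proof (induction N arbitrary: u)
  case 0
  then show ?case using sub by (simp add: act_one)
next
  case (Suc N)
  have "act (\<gamma> [^]\<^bsub>PU h\<^esub> Suc N) (\<alpha> u) = act (\<gamma> [^]\<^bsub>PU h\<^esub> N) (\<alpha> (u + v))"
    using assms(1) sub tr Suc.prems by (simp add: act_mult)
  also have "\<dots> = \<alpha> (u + v + real N *\<^sub>R v)"
    using Suc V by (simp add: vec.subspace_add)
  finally show ?case
    by (simp add: algebra_simps)
qed

lemma act_pow_fixed:
  assumes "\<gamma> \<in> carrier (PU h)" "vec.subspace S" "act \<gamma> S = S"
  shows "act (\<gamma> [^]\<^bsub>PU h\<^esub> (N::nat)) S = S"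
  using assms by (induction N) (simp_all add: act_one act_mult)

lemma act_conj:
  assumes "a \<in> carrier (PU h)" "\<gamma> \<in> carrier (PU h)" "vec.subspace S"
  shows "act (a \<otimes>\<^bsub>PU h\<^esub> \<gamma> \<otimes>\<^bsub>PU h\<^esub> inv\<^bsub>PU h\<^esub> a) (act a S) = act a (act \<gamma> S)"
  using assms by (simp add: act_mult subspace_act act_inv_cancel)

text \<open>The condition that defines a cusp passes to the \<open>N\<close>-th power of a parabolic element, which is
  nontrivial because \<open>\<Gamma>\<close> is torsion-free.\<close>

lemma cusp_transport:
  assumes \<Gamma>: "subgroup \<Gamma> (PU h)" "torsion_free (PU h) \<Gamma>"
    and tr: "\<And>b \<gamma>. b \<in> cusps h \<Gamma> \<Longrightarrow> \<gamma> \<in> stabilizer_in \<Gamma> b \<Longrightarrow> acts_by_translation h b \<gamma>"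
    and a: "a \<in> carrier (PU h)"
    and N: "N > 0" "\<And>\<gamma>. \<gamma> \<in> \<Gamma> \<Longrightarrow> a \<otimes>\<^bsub>PU h\<^esub> \<gamma> [^]\<^bsub>PU h\<^esub> (N::nat) \<otimes>\<^bsub>PU h\<^esub> inv\<^bsub>PU h\<^esub> a \<in> \<Delta>"
    and b: "b \<in> cusps h \<Gamma>"
  shows "act a b \<in> cusps h \<Delta>"
proof -
  obtain \<gamma> where \<gamma>: "\<gamma> \<in> \<Gamma>" "act \<gamma> b = b" "parabolic h \<gamma>" and iso: "b \<in> isotropic_lines h"
    using b by (auto simp: cusps_def stabilizer_in_def)
  have sub: "vec.subspace b" using iso by (simp add: isotropic_lines_def)
  have carr: "\<gamma> \<in> carrier (PU h)" using \<gamma>(3) by (simp add: parabolic_def)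
  have "acts_by_translation h b \<gamma>"
    using tr[OF b] \<gamma> by (simp add: stabilizer_in_def)
  moreover have "\<gamma> [^]\<^bsub>PU h\<^esub> N \<noteq> \<one>\<^bsub>PU h\<^esub>"
    using \<Gamma>(2) \<gamma> N(1) parabolic_not_one by (auto simp: torsion_free_def)
  ultimately have "parabolic h (\<gamma> [^]\<^bsub>PU h\<^esub> N)"
    using parabolic_pow iso \<gamma> by blast
  then have "parabolic h (a \<otimes>\<^bsub>PU h\<^esub> \<gamma> [^]\<^bsub>PU h\<^esub> N \<otimes>\<^bsub>PU h\<^esub> inv\<^bsub>PU h\<^esub> a)"
    by (rule parabolic_conj[OF a])
  moreover have "act (a \<otimes>\<^bsub>PU h\<^esub> \<gamma> [^]\<^bsub>PU h\<^esub> N \<otimes>\<^bsub>PU h\<^esub> inv\<^bsub>PU h\<^esub> a) (act a b) = act a b"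
    using a carr sub \<gamma> by (simp add: act_conj act_pow_fixed)
  ultimately show ?thesis
    using N(2)[OF \<gamma>(1)] act_isotropic[OF a iso] by (auto simp: cusps_def stabilizer_in_def)
qed

lemma translation_transport:
  fixes N :: nat
  assumes sub: "\<And>u. u \<in> V \<Longrightarrow> vec.subspace (\<alpha> u)" "vec.subspace b" and V: "vec.subspace V" "v \<in> V"
    and \<gamma>: "\<gamma> \<in> carrier (PU h)" "act \<gamma> b = b" and tr: "\<forall>u\<in>V. act \<gamma> (\<alpha> u) = \<alpha> (u + v)"
    and a: "a \<in> carrier (PU h)"
  defines "\<delta> \<equiv> a \<otimes>\<^bsub>PU h\<^esub> \<gamma> [^]\<^bsub>PU h\<^esub> N \<otimes>\<^bsub>PU h\<^esub> inv\<^bsub>PU h\<^esub> a"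
  shows "act \<delta> (act a b) = act a b" "\<forall>u\<in>V. act \<delta> (act a (\<alpha> u)) = act a (\<alpha> (u + real N *\<^sub>R v))"
  using act_pow_translation[OF \<gamma>(1) sub(1) V tr] act_pow_fixed[OF \<gamma>(1) sub(2) \<gamma>(2)] a \<gamma>(1) sub
  by (simp_all add: \<delta>_def act_conj)

text \<open>The cusp and the chart are moved by \<open>a\<close>. In the new chart the stabilizer acts by the translations
  \<open>\<Lambda>'\<close>, and taking \<open>N\<close>-th and \<open>M\<close>-th powers gives \<open>N \<Lambda> \<subseteq> \<Lambda>'\<close> and \<open>M \<Lambda>' \<subseteq> \<Lambda>\<close>. This makes
  \<open>V/\<Lambda>'\<close> an abelian variety isogenous to \<open>V/\<Lambda>\<close>.\<close>

lemma boundary_isogeny_class_transport: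
  assumes \<Gamma>: "subgroup \<Gamma> (PU h)" "torsion_free (PU h) \<Gamma>"
    and tr_\<Gamma>: "\<And>b \<gamma>. b \<in> cusps h \<Gamma> \<Longrightarrow> \<gamma> \<in> stabilizer_in \<Gamma> b \<Longrightarrow> acts_by_translation h b \<gamma>"
    and \<Delta>: "subgroup \<Delta> (PU h)"
    and tr_\<Delta>: "\<And>b \<gamma>. b \<in> cusps h \<Delta> \<Longrightarrow> \<gamma> \<in> stabilizer_in \<Delta> b \<Longrightarrow> acts_by_translation h b \<gamma>"
    and a: "a \<in> carrier (PU h)"
    and N: "N > 0" "\<And>\<gamma>. \<gamma> \<in> \<Gamma> \<Longrightarrow> a \<otimes>\<^bsub>PU h\<^esub> \<gamma> [^]\<^bsub>PU h\<^esub> (N::nat) \<otimes>\<^bsub>PU h\<^esub> inv\<^bsub>PU h\<^esub> a \<in> \<Delta>"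
    and M: "M > 0" "\<And>\<delta>. \<delta> \<in> \<Delta> \<Longrightarrow> inv\<^bsub>PU h\<^esub> a \<otimes>\<^bsub>PU h\<^esub> \<delta> [^]\<^bsub>PU h\<^esub> (M::nat) \<otimes>\<^bsub>PU h\<^esub> a \<in> \<Gamma>"
  shows "boundary_isogeny_classes h \<Gamma> \<subseteq> boundary_isogeny_classes h \<Delta>"
proof
  fix X assume "X \<in> boundary_isogeny_classes h \<Gamma>"
  then obtain V \<Lambda> b \<alpha> where X: "X = isogeny_class (V, \<Lambda>)" and A: "abelian_variety (V, \<Lambda>)"
    and b: "b \<in> cusps h \<Gamma>" and iso: "affine_iso h b V \<alpha>"
    and orbits: "\<And>u v. u \<in> V \<Longrightarrow> v \<in> V \<Longrightarrow>
        (\<exists>\<gamma>\<in>stabilizer_in \<Gamma> b. act \<gamma> (\<alpha> u) = \<alpha> v) \<longleftrightarrow> v - u \<in> \<Lambda>"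
    unfolding boundary_isogeny_classes_def boundary_abelian_varieties_def by auto
  have tor: "complex_torus (V, \<Lambda>)" using A by (simp add: abelian_variety_def)
  have V: "vec.subspace V" and "span \<Lambda> = V"
    using tor by (simp_all add: complex_torus_def)
  then have LV: "x \<in> V" if "x \<in> \<Lambda>" for x using that span_base by blast
  have V0: "0 \<in> V" using V by (rule vec.subspace_0)
  have bi: "b \<in> isotropic_lines h" using b by (simp add: cusps_def)
  then have b_sub: "vec.subspace b" by (simp add: isotropic_lines_def)
  have inj: "inj_on \<alpha> V" and \<alpha>_cusp: "\<And>u. u \<in> V \<Longrightarrow> \<alpha> u \<in> cusp_space h b"
    using iso by (auto simp: affine_iso_def bij_betw_def)
  have \<alpha>_sub: "vec.subspace (\<alpha> u)" if "u \<in> V" for u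
    using \<alpha>_cusp[OF that] by (rule subspace_cusp_space)
  have \<Gamma>_carr: "\<gamma> \<in> carrier (PU h)" if "\<gamma> \<in> \<Gamma>" for \<gamma>
    using \<Gamma>(1) that by (rule subgroup.mem_carrier)
  have \<Delta>_carr: "\<delta> \<in> carrier (PU h)" if "\<delta> \<in> \<Delta>" for \<delta>
    using \<Delta> that by (rule subgroup.mem_carrier)
  let ?b = "act a b" and ?i = "inv\<^bsub>PU h\<^esub> a"
  define \<beta> where "\<beta> u = act a (\<alpha> u)" for u
  have i: "?i \<in> carrier (PU h)" "inv\<^bsub>PU h\<^esub> ?i = a" using a by simp_all
  have b': "?b \<in> cusps h \<Delta>"
    using cusp_transport[OF \<Gamma> tr_\<Gamma> a N b] .
  then have b'i: "?b \<in> isotropic_lines h" by (simp add: cusps_def)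
  then have b'_sub: "vec.subspace ?b" by (simp add: isotropic_lines_def)
  have iso': "affine_iso h ?b V \<beta>"
    using affine_iso_act[OF a b_sub iso] by (simp add: \<beta>_def[abs_def])
  have inj': "inj_on \<beta> V" and \<beta>_cusp: "\<And>u. u \<in> V \<Longrightarrow> \<beta> u \<in> cusp_space h ?b"
    using iso' by (auto simp: affine_iso_def bij_betw_def)
  have \<beta>_sub: "vec.subspace (\<beta> u)" if "u \<in> V" for u
    using \<beta>_cusp[OF that] by (rule subspace_cusp_space)
  have pull_back: "act ?i (\<beta> u) = \<alpha> u" if "u \<in> V" for u
    unfolding \<beta>_def using act_inv_cancel(1)[OF a \<alpha>_sub[OF that]] .
  have \<Lambda>: "\<exists>\<gamma>\<in>stabilizer_in \<Gamma> b. \<forall>u\<in>V. act \<gamma> (\<alpha> u) = \<alpha> (u + x)" if x: "x \<in> \<Lambda>" for x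
  proof -
    obtain \<gamma> where \<gamma>: "\<gamma> \<in> stabilizer_in \<Gamma> b" "act \<gamma> (\<alpha> 0) = \<alpha> x"
      using orbits[OF V0 LV[OF x]] x by auto
    then obtain v where v: "v \<in> V" "\<forall>u\<in>V. act \<gamma> (\<alpha> u) = \<alpha> (u + v)"
      using translation_in_chart[OF bi iso V, of \<gamma>] tr_\<Gamma>[OF b] \<Gamma>_carr by (auto simp: stabilizer_in_def)
    then have "\<alpha> v = \<alpha> x" using \<gamma>(2) V0 by simp
    then have "v = x" using inj v(1) LV[OF x] by (auto dest: inj_onD)
    then show ?thesis using v \<gamma> by blast
  qed
  have in_\<Lambda>: "x \<in> \<Lambda>" if "x \<in> V" "\<gamma> \<in> stabilizer_in \<Gamma> b" "act \<gamma> (\<alpha> 0) = \<alpha> x" for x \<gamma>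
    using orbits[OF V0 that(1)] that by auto
  define \<Lambda>' where "\<Lambda>' = {x \<in> V. \<exists>\<delta>\<in>stabilizer_in \<Delta> ?b. \<forall>u\<in>V. act \<delta> (\<beta> u) = \<beta> (u + x)}"
  have orbits': "(\<exists>\<delta>\<in>stabilizer_in \<Delta> ?b. act \<delta> (\<beta> u) = \<beta> v) \<longleftrightarrow> v - u \<in> \<Lambda>'"
    if uv: "u \<in> V" "v \<in> V" for u v
  proof
    assume "\<exists>\<delta>\<in>stabilizer_in \<Delta> ?b. act \<delta> (\<beta> u) = \<beta> v"
    then obtain \<delta> where \<delta>: "\<delta> \<in> stabilizer_in \<Delta> ?b" "act \<delta> (\<beta> u) = \<beta> v" by blast
    then obtain x where x: "x \<in> V" "\<forall>u\<in>V. act \<delta> (\<beta> u) = \<beta> (u + x)"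
      using translation_in_chart[OF b'i iso' V, of \<delta>] tr_\<Delta>[OF b'] \<Delta>_carr
      by (auto simp: stabilizer_in_def)
    then have "\<beta> (u + x) = \<beta> v" using \<delta> uv by simp
    then have "u + x = v"
      using inj' uv x(1) V by (auto dest: inj_onD simp: vec.subspace_add)
    then have "v - u = x" by auto
    then show "v - u \<in> \<Lambda>'" using x \<delta>(1) by (auto simp: \<Lambda>'_def)
  next
    assume "v - u \<in> \<Lambda>'"
    then obtain \<delta> where "\<delta> \<in> stabilizer_in \<Delta> ?b" "\<forall>w\<in>V. act \<delta> (\<beta> w) = \<beta> (w + (v - u))"
      by (auto simp: \<Lambda>'_def)
    then show "\<exists>\<delta>\<in>stabilizer_in \<Delta> ?b. act \<delta> (\<beta> u) = \<beta> v"
      using uv(1) by (intro bexI[of _ \<delta>]) auto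
  qed
  have zero': "0 \<in> \<Lambda>'"
    unfolding \<Lambda>'_def using V0 subgroup.one_closed[OF \<Delta>] act_one[OF b'_sub] act_one[OF \<beta>_sub]
    by (auto simp: stabilizer_in_def)
  have diff': "x - y \<in> \<Lambda>'" if xy: "x \<in> \<Lambda>'" "y \<in> \<Lambda>'" for x y
  proof -
    obtain \<delta> where \<delta>: "\<delta> \<in> \<Delta>" "act \<delta> ?b = ?b" "\<forall>u\<in>V. act \<delta> (\<beta> u) = \<beta> (u + x)"
      using xy(1) by (auto simp: \<Lambda>'_def stabilizer_in_def)
    obtain \<epsilon> where \<epsilon>: "\<epsilon> \<in> \<Delta>" "act \<epsilon> ?b = ?b" "\<forall>u\<in>V. act \<epsilon> (\<beta> u) = \<beta> (u + y)"
      using xy(2) by (auto simp: \<Lambda>'_def stabilizer_in_def)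
    have x: "x \<in> V" and y: "y \<in> V" using xy by (simp_all add: \<Lambda>'_def)
    let ?\<epsilon> = "inv\<^bsub>PU h\<^esub> \<epsilon>"
    have carr: "\<delta> \<in> carrier (PU h)" "\<epsilon> \<in> carrier (PU h)" "?\<epsilon> \<in> carrier (PU h)"
      using \<delta> \<epsilon> \<Delta>_carr by simp_all
    have pull_back_\<epsilon>: "act ?\<epsilon> (\<beta> u) = \<beta> (u - y)" if "u \<in> V" for u
    proof -
      have uy: "u - y \<in> V" using V that y by (simp add: vec.subspace_diff)
      then have "act \<epsilon> (\<beta> (u - y)) = \<beta> u" using \<epsilon>(3) by simp
      then show ?thesis using act_inv_cancel(1)[OF carr(2) \<beta>_sub[OF uy]] by simp
    qed
    have "act ?\<epsilon> ?b = ?b"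
      using act_inv_cancel(1)[OF carr(2) b'_sub] \<epsilon>(2) by simp
    then have "\<delta> \<otimes>\<^bsub>PU h\<^esub> ?\<epsilon> \<in> stabilizer_in \<Delta> ?b"
      using \<delta> \<epsilon> carr \<Delta> b'_sub
      by (simp add: stabilizer_in_def act_mult subgroup.m_closed subgroup.m_inv_closed)
    moreover have "act (\<delta> \<otimes>\<^bsub>PU h\<^esub> ?\<epsilon>) (\<beta> u) = \<beta> (u + (x - y))" if "u \<in> V" for u
    proof -
      have "u - y \<in> V" using V that y by (simp add: vec.subspace_diff)
      then show ?thesis
        using \<delta>(3) carr \<beta>_sub[OF that] that by (simp add: act_mult pull_back_\<epsilon> algebra_simps)
    qed
    ultimately show ?thesis
      using V x y by (auto simp: \<Lambda>'_def vec.subspace_diff)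
  qed
  have N_scale: "real N *\<^sub>R x \<in> \<Lambda>'" if x: "x \<in> \<Lambda>" for x
  proof -
    obtain \<gamma> where \<gamma>: "\<gamma> \<in> \<Gamma>" "act \<gamma> b = b" "\<forall>u\<in>V. act \<gamma> (\<alpha> u) = \<alpha> (u + x)"
      using \<Lambda>[OF x] by (auto simp: stabilizer_in_def)
    note tt = translation_transport[OF \<alpha>_sub b_sub V LV[OF x] \<Gamma>_carr[OF \<gamma>(1)] \<gamma>(2,3) a, of N]
    show ?thesis
      using tt N(2)[OF \<gamma>(1)] subspace_scaleR[OF V LV[OF x]]
      by (auto simp: \<Lambda>'_def stabilizer_in_def \<beta>_def)
  qed
  have M_scale: "real M *\<^sub>R x \<in> \<Lambda>" if x: "x \<in> \<Lambda>'" for x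
  proof -
    obtain \<delta> where \<delta>: "\<delta> \<in> \<Delta>" "act \<delta> ?b = ?b" "\<forall>u\<in>V. act \<delta> (\<beta> u) = \<beta> (u + x)"
      using x by (auto simp: \<Lambda>'_def stabilizer_in_def)
    have xV: "x \<in> V" using x by (simp add: \<Lambda>'_def)
    note tt = translation_transport[OF \<beta>_sub b'_sub V xV \<Delta>_carr[OF \<delta>(1)] \<delta>(2,3) i(1), of M]
    let ?\<gamma> = "?i \<otimes>\<^bsub>PU h\<^esub> \<delta> [^]\<^bsub>PU h\<^esub> M \<otimes>\<^bsub>PU h\<^esub> a"
    have Mx: "real M *\<^sub>R x \<in> V" using subspace_scaleR[OF V xV] .
    have "act ?\<gamma> b = b"
      using tt(1) by (simp add: i act_inv_cancel(1)[OF a b_sub])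
    moreover have "act ?\<gamma> (\<alpha> 0) = \<alpha> (real M *\<^sub>R x)"
      using bspec[OF tt(2) V0] pull_back V0 Mx by (simp add: i)
    ultimately show ?thesis
      using M(2)[OF \<delta>(1)] by (intro in_\<Lambda>[OF Mx, of ?\<gamma>]) (simp_all add: stabilizer_in_def)
  qed
  have A': "abelian_variety (V, \<Lambda>')"
    using abelian_variety_if_commensurable[OF A _ zero' diff' N(1) N_scale M(1) M_scale]
    by (auto simp: \<Lambda>'_def)
  then have "(V, \<Lambda>') \<in> boundary_abelian_varieties h \<Delta>"
    unfolding boundary_abelian_varieties_def mem_Collect_eq prod.case
    by (intro conjI bexI[OF _ b'] exI[of _ \<beta>] iso' ballI orbits')
  moreover have "complex_torus (V, \<Lambda>')"
    using A' by (simp add: abelian_variety_def)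
  then have "X = isogeny_class (V, \<Lambda>')"
    unfolding X using isogeny_class_eq_if_commensurable[OF tor _ N(1) N_scale M(1) M_scale] by blast
  ultimately show "X \<in> boundary_isogeny_classes h \<Delta>"
    by (auto simp: boundary_isogeny_classes_def)
qed

end


section \<open>Commensurable lattices have isogenous boundaries\<close>

theorem proposition8p1:
  fixes h :: "complex^'m::finite \<Rightarrow> complex^'m \<Rightarrow> complex" and n :: nat
    and \<Gamma>1 \<Gamma>2 \<Gamma>1' \<Gamma>2' :: "(complex^'m^'m) set set"
  assumes "hermitian_form h" and "signature_1_n h n"
    and "lattice_in_PU h \<Gamma>1" and "lattice_in_PU h \<Gamma>2"
    and "commensurable (PU h) \<Gamma>1 \<Gamma>2"
    and "admissible_subgroup h \<Gamma>1 \<Gamma>1'" and "admissible_subgroup h \<Gamma>2 \<Gamma>2'"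
  shows "boundary_isogeny_classes h \<Gamma>1' = boundary_isogeny_classes h \<Gamma>2'"
proof -
  interpret lorentzian_form h
    using assms(1,2) by (rule lorentzian_form_if_signature)
  have sub: "subgroup \<Gamma>1 (PU h)" "subgroup \<Gamma>2 (PU h)"
    using assms(3,4) by (simp_all add: lattice_subgroup_def)
  have fin: "finite_index_subgroup (PU h) \<Gamma>1 \<Gamma>1'" "finite_index_subgroup (PU h) \<Gamma>2 \<Gamma>2'"
    and tf: "torsion_free (PU h) \<Gamma>1'" "torsion_free (PU h) \<Gamma>2'"
    and tr: "\<And>b \<gamma>. b \<in> cusps h \<Gamma>1' \<Longrightarrow> \<gamma> \<in> stabilizer_in \<Gamma>1' b \<Longrightarrow> acts_by_translation h b \<gamma>"
      "\<And>b \<gamma>. b \<in> cusps h \<Gamma>2' \<Longrightarrow> \<gamma> \<in> stabilizer_in \<Gamma>2' b \<Longrightarrow> acts_by_translation h b \<gamma>"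
    using assms(6,7) by (auto simp: admissible_subgroup_def)
  have sub': "subgroup \<Gamma>1' (PU h)" "subgroup \<Gamma>2' (PU h)"
    using fin sub PU.incl_subgroup by (auto simp: finite_index_subgroup_def)
  obtain a N M where a: "a \<in> carrier (PU h)"
    and N: "N > (0::nat)" "\<And>x. x \<in> \<Gamma>1' \<Longrightarrow> a \<otimes>\<^bsub>PU h\<^esub> x [^]\<^bsub>PU h\<^esub> N \<otimes>\<^bsub>PU h\<^esub> inv\<^bsub>PU h\<^esub> a \<in> \<Gamma>2'"
    and M: "M > (0::nat)" "\<And>x. x \<in> \<Gamma>2' \<Longrightarrow> inv\<^bsub>PU h\<^esub> a \<otimes>\<^bsub>PU h\<^esub> x [^]\<^bsub>PU h\<^esub> M \<otimes>\<^bsub>PU h\<^esub> a \<in> \<Gamma>1'"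
    using PU.commensurable_uniform_powers[OF sub assms(5) fin] by blast
  show ?thesis
  proof
    show "boundary_isogeny_classes h \<Gamma>1' \<subseteq> boundary_isogeny_classes h \<Gamma>2'"
      using sub'(1) tf(1) tr(1) sub'(2) tr(2) a N M by (rule boundary_isogeny_class_transport)
    have i: "inv\<^bsub>PU h\<^esub> a \<in> carrier (PU h)" "inv\<^bsub>PU h\<^esub> (inv\<^bsub>PU h\<^esub> a) = a"
      using a by simp_all
    show "boundary_isogeny_classes h \<Gamma>2' \<subseteq> boundary_isogeny_classes h \<Gamma>1'"
      using sub'(2) tf(2) tr(2) sub'(1) tr(1) i(1) M(1) _ N(1)
      by (rule boundary_isogeny_class_transport) (simp_all add: i M N)
  qed
qed

end
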